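(* There exist continuum many pairwise non-isomorphic infinite simple groups which are all integrally acyclic.
   Context: A group $\Gamma$ is integrally acyclic if its group homology with trivial integer coefficients satisfies $H_*(\Gamma,\mathbb{Z})\cong\{0\}$ for all $*>0$. *)

theory Defs
  imports
    Complex_Main
    "HOL-Algebra.Coset"
    "HOL-Algebra.Elementary_Groups"
    "HOL-Algebra.Free_Abelian_Groups"
    "HOL-Library.Equipollence"
begin

text \<open>
  The locale \<open>simple_group\<close> of HOL-Algebra demands \<open>order G > 1\<close>, where the order is the
  cardinality as a natural number and hence \<open>0\<close> for an infinite group. It therefore only admits
  finite groups; the following is the same notion without that restriction.
\<close>

definition is_simple_group :: "('a, 'b) monoid_scheme \<Rightarrow> bool" where
  "is_simple_group G \<longleftrightarrow>
     group G \<and> carrier G \<noteq> {\<one>\<^bsub>G\<^esub>} \<and>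
     (\<forall>N. N \<lhd> G \<longrightarrow> N = carrier G \<or> N = {\<one>\<^bsub>G\<^esub>})"

text \<open>
  Group homology with trivial integer coefficients, as the homology of the inhomogeneous bar
  complex: in degree \<open>n\<close> the free abelian group on the \<open>n\<close>-tuples \<open>[g\<^sub>1, \<dots>, g\<^sub>n]\<close> over \<open>G\<close>, with
  \<open>\<partial>[g\<^sub>1, \<dots>, g\<^sub>n] = [g\<^sub>2, \<dots>, g\<^sub>n]
     + (\<Sum>0<i<n. (-1)\<^sup>i [g\<^sub>1, \<dots>, g\<^sub>i g\<^sub>i\<^sub>+\<^sub>1, \<dots>, g\<^sub>n]) + (-1)\<^sup>n [g\<^sub>1, \<dots>, g\<^sub>n\<^sub>-\<^sub>1]\<close>.
\<close>

definition bar_tuples :: "('a, 'b) monoid_scheme \<Rightarrow> nat \<Rightarrow> 'a list set" where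
  "bar_tuples G n = {xs. length xs = n \<and> set xs \<subseteq> carrier G}"

definition bar_chains :: "('a, 'b) monoid_scheme \<Rightarrow> nat \<Rightarrow> ('a list \<Rightarrow>\<^sub>0 int) monoid" where
  "bar_chains G n = free_Abelian_group (bar_tuples G n)"

definition bar_face :: "('a, 'b) monoid_scheme \<Rightarrow> nat \<Rightarrow> 'a list \<Rightarrow> 'a list" where
  "bar_face G i xs =
     (if i = 0 then tl xs
      else if i = length xs then butlast xs
      else take (i - 1) xs @ (xs ! (i - 1) \<otimes>\<^bsub>G\<^esub> xs ! i) # drop (i + 1) xs)"

definition bar_boundary ::
    "('a, 'b) monoid_scheme \<Rightarrow> nat \<Rightarrow> ('a list \<Rightarrow>\<^sub>0 int) \<Rightarrow> ('a list \<Rightarrow>\<^sub>0 int)" where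
  "bar_boundary G n c =
     (if n = 0 then 0
      else frag_extend (\<lambda>xs. \<Sum>i\<le>n. frag_cmul ((- 1) ^ i) (frag_of (bar_face G i xs))) c)"

definition bar_cycles :: "('a, 'b) monoid_scheme \<Rightarrow> nat \<Rightarrow> ('a list \<Rightarrow>\<^sub>0 int) set" where
  "bar_cycles G n = {c \<in> carrier (bar_chains G n). bar_boundary G n c = 0}"

definition bar_boundaries :: "('a, 'b) monoid_scheme \<Rightarrow> nat \<Rightarrow> ('a list \<Rightarrow>\<^sub>0 int) set" where
  "bar_boundaries G n = bar_boundary G (Suc n) ` carrier (bar_chains G (Suc n))"

definition group_homology ::
    "('a, 'b) monoid_scheme \<Rightarrow> nat \<Rightarrow> ('a list \<Rightarrow>\<^sub>0 int) set monoid" where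
  "group_homology G n =
     subgroup_generated (bar_chains G n) (bar_cycles G n) Mod bar_boundaries G n"

definition integrally_acyclic :: "('a, 'b) monoid_scheme \<Rightarrow> bool" where
  "integrally_acyclic G \<longleftrightarrow> (\<forall>n>0. trivial_group (group_homology G n))"

lemma length_bar_face: "length xs = Suc n \<Longrightarrow> i \<le> Suc n \<Longrightarrow> length (bar_face G i xs) = n"
  by (auto simp: bar_face_def)

lemma nth_bar_face:
  assumes "length xs = Suc n" "i \<le> Suc n" "k < n"
  shows "bar_face G i xs ! k =
    (if Suc k < i then xs ! k else if Suc k = i then xs ! k \<otimes>\<^bsub>G\<^esub> xs ! Suc k else xs ! Suc k)"
proof (cases "i = 0 \<or> i = Suc n")
  case True
  then show ?thesis
    using assms by (auto simp: bar_face_def nth_tl nth_butlast)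
next
  case False
  then obtain j where j: "i = Suc j" "j < n"
    using assms by (metis le_neq_implies_less not0_implies_Suc Suc_less_eq)
  then show ?thesis
    using assms
    by (auto simp: bar_face_def nth_append nth_Cons min_def split: nat.split)
       (metis Suc_diff_Suc less_Suc_eq not_less_eq diff_Suc_Suc le_add_diff_inverse
          less_or_eq_imp_le add_Suc_right nat_less_le)+
qed

lemma bar_face_in_bar_tuples:
  assumes "group G" "xs \<in> bar_tuples G (Suc n)" "i \<le> Suc n"
  shows "bar_face G i xs \<in> bar_tuples G n"
proof -
  interpret group G by fact
  have l: "length xs = Suc n" and c: "\<And>k. k < Suc n \<Longrightarrow> xs ! k \<in> carrier G"
    using assms(2) by (auto simp: bar_tuples_def subset_iff)
  have "bar_face G i xs ! k \<in> carrier G" if "k < n" for k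
    using that by (simp add: nth_bar_face[OF l assms(3) that] c)
  then show ?thesis
    by (auto simp: bar_tuples_def in_set_conv_nth length_bar_face[OF l assms(3)])
qed

lemma bar_face_bar_face:
  assumes "group G" "xs \<in> bar_tuples G (Suc (Suc n))" "i \<le> j" "j \<le> Suc n"
  shows "bar_face G i (bar_face G (Suc j) xs) = bar_face G j (bar_face G i xs)"
proof -
  interpret group G by fact
  have l: "length xs = Suc (Suc n)" and c: "\<And>k. k < Suc (Suc n) \<Longrightarrow> xs ! k \<in> carrier G"
    using assms(2) by (auto simp: bar_tuples_def subset_iff)
  have l1: "length (bar_face G (Suc j) xs) = Suc n" and l2: "length (bar_face G i xs) = Suc n"
    using l assms by (auto intro: length_bar_face)
  show ?thesis
  proof (rule nth_equalityI)
    show "length (bar_face G i (bar_face G (Suc j) xs)) = length (bar_face G j (bar_face G i xs))"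
      using assms(3,4) by (simp add: length_bar_face[OF l1] length_bar_face[OF l2])
  next
    fix k assume "k < length (bar_face G i (bar_face G (Suc j) xs))"
    then have k: "k < n"
      using assms(3,4) by (simp add: length_bar_face[OF l1])
    then show "bar_face G i (bar_face G (Suc j) xs) ! k = bar_face G j (bar_face G i xs) ! k"
      using assms(3,4) c
      by (auto simp: nth_bar_face[OF l1] nth_bar_face[OF l2] nth_bar_face[OF l] m_assoc)
  qed
qed

lemma bar_boundary_of:
  "bar_boundary G (Suc n) (frag_of xs) =
     (\<Sum>i\<le>Suc n. frag_cmul ((- 1) ^ i) (frag_of (bar_face G i xs)))"
  by (simp add: bar_boundary_def)

lemma bar_boundary_bar_boundary_of:
  assumes "group G" "xs \<in> bar_tuples G (Suc (Suc n))"
  shows "bar_boundary G (Suc n) (bar_boundary G (Suc (Suc n)) (frag_of xs)) = 0"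
proof -
  define F where "F i j = frag_cmul ((- 1) ^ (i + j)) (frag_of (bar_face G i (bar_face G j xs)))"
    for i j
  let ?A = "{..Suc (Suc n)} \<times> {..Suc n}"
  let ?L = "{p \<in> ?A. snd p < fst p}" and ?U = "{p \<in> ?A. fst p \<le> snd p}"
  have "bar_boundary G (Suc n) (bar_boundary G (Suc (Suc n)) (frag_of xs)) =
      (\<Sum>j\<le>Suc (Suc n). \<Sum>i\<le>Suc n. F i j)"
    unfolding bar_boundary_of
    by (simp add: bar_boundary_def frag_extend_sum frag_extend_cmul F_def frag_cmul_sum power_add
        mult.commute del: sum.atMost_Suc)
  also have "\<dots> = (\<Sum>p\<in>?A. F (snd p) (fst p))"
    by (simp add: sum.cartesian_product case_prod_unfold del: sum.atMost_Suc)
  also have "\<dots> = (\<Sum>p\<in>?L. F (snd p) (fst p)) + (\<Sum>p\<in>?U. F (snd p) (fst p))"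
    by (subst sum.union_disjoint[symmetric]) (auto intro!: sum.cong)
  also have "(\<Sum>p\<in>?L. F (snd p) (fst p)) = (\<Sum>p\<in>?U. - F (snd p) (fst p))"
  proof (rule sum.reindex_bij_witness[where i = "\<lambda>(i, j). (Suc j, i)" and j = "\<lambda>(j, i). (i, j - 1)"])
    fix p assume p: "p \<in> ?L"
    obtain j i where pe: "p = (Suc j, i)" "i \<le> j" "j \<le> Suc n"
      using p by (cases p; cases "fst p") auto
    show "- F (snd (case p of (j, i) \<Rightarrow> (i, j - 1))) (fst (case p of (j, i) \<Rightarrow> (i, j - 1)))
        = F (snd p) (fst p)"
      using bar_face_bar_face[OF assms pe(2,3)] by (simp add: pe(1) F_def add.commute)
  qed auto
  finally show ?thesis
    by (simp add: sum_negf)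
qed

lemma bar_boundary_in_bar_chains:
  assumes "group G" "c \<in> carrier (bar_chains G (Suc n))"
  shows "bar_boundary G (Suc n) c \<in> carrier (bar_chains G n)"
proof -
  have "Poly_Mapping.keys (\<Sum>i\<le>Suc n. frag_cmul ((- 1) ^ i) (frag_of (bar_face G i xs)))
      \<subseteq> bar_tuples G n" if "xs \<in> bar_tuples G (Suc n)" for xs
    using bar_face_in_bar_tuples[OF assms(1) that]
    by (intro order.trans[OF keys_sum]) (auto simp: keys_cmul)
  then show ?thesis
    using assms(2) unfolding bar_boundary_def bar_chains_def
    by (auto intro!: order.trans[OF keys_frag_extend] simp del: sum.atMost_Suc)
qed

lemma bar_boundary_bar_boundary:
  assumes "group G" "c \<in> carrier (bar_chains G (Suc n))"
  shows "bar_boundary G n (bar_boundary G (Suc n) c) = 0"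
proof (cases n)
  case 0
  then show ?thesis by (simp add: bar_boundary_def)
next
  case (Suc m)
  have bdiff: "bar_boundary G k (x - y) = bar_boundary G k x - bar_boundary G k y" for k x y
    by (simp add: bar_boundary_def frag_extend_diff)
  have "c \<in> carrier (free_Abelian_group (bar_tuples G (Suc n)))"
    using assms(2) by (simp add: bar_chains_def)
  then have "Poly_Mapping.keys c \<subseteq> bar_tuples G (Suc n)" by simp
  then show ?thesis
  proof (induction c rule: frag_induction)
    case zero
    then show ?case by (simp add: bar_boundary_def)
  next
    case (one x)
    then show ?case using bar_boundary_bar_boundary_of[OF assms(1)] Suc by blast
  next
    case (diff a b)
    then show ?case by (simp add: bdiff)
  qed
qed

lemma bar_boundaries_subset_bar_cycles:
  "group G \<Longrightarrow> bar_boundaries G n \<subseteq> bar_cycles G n"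
  by (auto simp: bar_boundaries_def bar_cycles_def bar_boundary_in_bar_chains
      bar_boundary_bar_boundary)

end

theory Submission
  imports Defs "HOL-Analysis.Abstract_Topology_2"
begin

text \<open>
  The groups are countable subgroups of one very large permutation group. Let \<open>V\<close> be an infinite
  set with \<open>V \<times> V\<close> and \<open>V\<^sup>\<int>\<close> in bijection with \<open>V\<close>, and let \<open>L\<close> be the union of the chain \<open>Sym V
  \<le> Sym (V \<times> V) \<le> Sym (V \<times> V \<times> V) \<le> \<dots>\<close>, where a permutation is extended by the identity on the
  new factor. The group \<open>L\<close> has the two properties that are wanted.

  \<^item> It is simple (\<open>simple_limgrp\<close>): at the next stage of the chain a non-trivial permutation
  moves a set of full cardinality off itself, and then commutators of commutators produce every
  permutation (\<open>perm_normal_pair\<close>).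

  \<^item> It carries swindles (\<open>swindle_tower_limgrp\<close>): identify the next stage with \<open>Sym (V\<^sup>\<int>)\<close> so
  that \<open>x \<in> Sym V\<close> acts on the coordinate \<open>0\<close>, and let \<open>b x\<close> act as \<open>x\<close> on every positive
  coordinate. Then \<open>b x\<close> commutes with the old stage, and the shift of coordinates conjugates \<open>b
  x\<close> to \<open>x b x\<close>.

  Such swindles kill homology (\<open>swindle_tower_acyclic\<close>). On chains, the homomorphism \<open>x \<mapsto> x b x\<close>
  is homotopic to the sum of the inclusion, of \<open>b\<close>, and of the cross terms of the
  Alexander-Whitney decomposition of the diagonal. As conjugation is homotopic to the identity,
  \<open>b\<close> and \<open>x \<mapsto> x b x\<close> cancel, and the inclusion is homotopic to minus the cross terms. These
  have both factors in positive degree, hence a null-homotopy of the inclusion through degree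
  \<open>n\<close> makes them null-homotopic through degree \<open>n + 1\<close>. So the inclusion of a stage is
  null-homotopic through degree \<open>n\<close> in the \<open>n\<close>-th stage after it (\<open>null_htpy_step\<close>). Keeping the
  homotopies, instead of the induced maps in homology, avoids the Kuenneth formula and its
  torsion terms.

  Both properties pass to subgroups that are closed under operations with countably many values,
  so every countable subset of \<open>L\<close> lies in a countable subgroup that inherits them
  (\<open>countable_simple_swindle_subgroup\<close>). A pair of elements \<open>g, h\<close> codes the set of those \<open>n\<close>
  for which \<open>g\<close> fails to commute with its conjugate by the power of \<open>h\<close> with exponent \<open>n + 1\<close>.
  Every set \<open>S\<close> of natural numbers is coded in \<open>L\<close>, so there is a countable simple acyclic group
  that codes \<open>S\<close>. A countable group codes only countably many sets, and isomorphic groups code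
  the same ones; hence continuum many isomorphism types are needed to code all \<open>S\<close>.
\<close>

section \<open>Chains of lists\<close>

abbreviation lin :: "('b \<Rightarrow> 'a \<Rightarrow>\<^sub>0 int) \<Rightarrow> ('b \<Rightarrow>\<^sub>0 int) \<Rightarrow> 'a \<Rightarrow>\<^sub>0 int" where
  "lin \<equiv> frag_extend"

abbreviation sg :: "nat \<Rightarrow> ('a \<Rightarrow>\<^sub>0 int) \<Rightarrow> ('a \<Rightarrow>\<^sub>0 int)" where
  "sg n \<equiv> frag_cmul ((- 1) ^ n)"

lemmas lin_simps = frag_extend_add frag_extend_diff frag_extend_minus frag_extend_cmul

lemma frag_cmul_diff: "frag_cmul k (a - b) = frag_cmul k a - frag_cmul k b"
  by (simp add: poly_mapping_eqI lookup_minus right_diff_distrib)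

lemma lin_lin: "lin f (lin g c) = lin (\<lambda>x. lin f (g x)) c"
  using subset_UNIV by (induction c rule: frag_induction) (simp_all add: lin_simps)

lemma lin_id [simp]: "lin frag_of c = c"
  using frag_expansion[of c] by simp

lemma lin_fun_zero [simp]: "lin (\<lambda>x. 0) c = 0"
  by (simp add: frag_extend_def)

lemma lin_fun_add: "lin (\<lambda>x. f x + g x) c = lin f c + lin g c"
  by (simp add: frag_extend_def frag_cmul_distrib2 sum.distrib)

lemma lin_fun_diff: "lin (\<lambda>x. f x - g x) c = lin f c - lin g c"
  by (simp add: frag_extend_def frag_cmul_diff sum_subtractf)

lemma lin_fun_minus: "lin (\<lambda>x. - f x) c = - lin f c"
  using lin_fun_diff[of "\<lambda>x. 0" f c] by simp

lemma lin_fun_cmul: "lin (\<lambda>x. frag_cmul k (f x)) c = frag_cmul k (lin f c)"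
  using subset_UNIV
  by (induction c rule: frag_induction) (simp_all add: lin_simps frag_cmul_diff)

lemma lin_swap: "lin (\<lambda>u. lin (\<lambda>v. f u v) d) c = lin (\<lambda>v. lin (\<lambda>u. f u v) c) d"
  using subset_UNIV
  by (induction c rule: frag_induction) (simp_all add: lin_simps lin_fun_diff)

lemmas lin_fun_simps = lin_fun_add lin_fun_diff lin_fun_minus lin_fun_cmul

definition tuples :: "'a set \<Rightarrow> nat \<Rightarrow> 'a list set" where
  "tuples X n = {l. length l = n \<and> set l \<subseteq> X}"

definition chains :: "'a set \<Rightarrow> nat \<Rightarrow> ('a list \<Rightarrow>\<^sub>0 int) set" where
  "chains X n = {c. Poly_Mapping.keys c \<subseteq> tuples X n}"

lemma chains_0 [simp]: "0 \<in> chains X n"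
  by (simp add: chains_def)

lemma chains_of [simp]: "frag_of l \<in> chains X n \<longleftrightarrow> l \<in> tuples X n"
  by (simp add: chains_def)

lemma chains_add [intro]: "a \<in> chains X n \<Longrightarrow> b \<in> chains X n \<Longrightarrow> a + b \<in> chains X n"
  using keys_add[of a b] by (auto simp: chains_def)

lemma chains_diff [intro]: "a \<in> chains X n \<Longrightarrow> b \<in> chains X n \<Longrightarrow> a - b \<in> chains X n"
  using keys_diff[of a b] by (auto simp: chains_def)

lemma chains_minus [intro]: "a \<in> chains X n \<Longrightarrow> - a \<in> chains X n"
  by (simp add: chains_def)

lemma chains_cmul [intro]: "a \<in> chains X n \<Longrightarrow> frag_cmul k a \<in> chains X n"
  by (auto simp: chains_def)

lemma chains_lin:
  assumes "c \<in> chains X m" "\<And>l. l \<in> tuples X m \<Longrightarrow> f l \<in> chains Y n"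
  shows "lin f c \<in> chains Y n"
  using assms keys_frag_extend[of f c] by (fastforce simp: chains_def)

lemma lin_cong_chains:
  "c \<in> chains X n \<Longrightarrow> (\<And>l. l \<in> tuples X n \<Longrightarrow> f l = g l) \<Longrightarrow> lin f c = lin g c"
  by (rule frag_extend_eq) (auto simp: chains_def)

lemma tuples_Cons [simp]: "x # l \<in> tuples X (Suc n) \<longleftrightarrow> x \<in> X \<and> l \<in> tuples X n"
  by (auto simp: tuples_def)

lemma tuples_0: "tuples X 0 = {[]}"
  by (auto simp: tuples_def)

lemma tuples_SucE:
  assumes "l \<in> tuples X (Suc n)"
  obtains x l' where "l = x # l'" "x \<in> X" "l' \<in> tuples X n"
  using assms by (cases l) (auto simp: tuples_def)

lemma tuples_mono: "X \<subseteq> Y \<Longrightarrow> l \<in> tuples X n \<Longrightarrow> l \<in> tuples Y n"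
  by (auto simp: tuples_def)

lemma chains_mono: "X \<subseteq> Y \<Longrightarrow> c \<in> chains X n \<Longrightarrow> c \<in> chains Y n"
  using tuples_mono[of X Y] by (fastforce simp: chains_def)

section \<open>The simplex spanned by a set and natural homotopies\<close>

text \<open>
  Lists over \<open>X\<close> are the simplices (with repetitions) spanned by points of \<open>X\<close>, and the empty
  list is the augmentation in degree \<open>-1\<close>. Group elements act on such lists, and the bar complex
  is the quotient by this action. Prepending a fixed vertex contracts the complex, which makes
  all homotopies below recursive definitions.
\<close>

definition prepend :: "'a \<Rightarrow> ('a list \<Rightarrow>\<^sub>0 int) \<Rightarrow> ('a list \<Rightarrow>\<^sub>0 int)" where
  "prepend x = lin (\<lambda>l. frag_of (x # l))"

text \<open>
  The alternating sum of the faces, in the recursive form that fits inductions on lists; the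
  closed form is \<open>bd_sum\<close>.
\<close>

fun bd :: "'a list \<Rightarrow> ('a list \<Rightarrow>\<^sub>0 int)" where
  "bd [] = 0"
| "bd (x # l) = frag_of l - prepend x (bd l)"

abbreviation BD :: "('a list \<Rightarrow>\<^sub>0 int) \<Rightarrow> ('a list \<Rightarrow>\<^sub>0 int)" where
  "BD \<equiv> lin bd"

definition push :: "('a \<Rightarrow> 'b) \<Rightarrow> ('a list \<Rightarrow>\<^sub>0 int) \<Rightarrow> ('b list \<Rightarrow>\<^sub>0 int)" where
  "push f = lin (\<lambda>l. frag_of (map f l))"

lemma prepend_of [simp]: "prepend x (frag_of l) = frag_of (x # l)"
  by (simp add: prepend_def)

lemma prepend_0 [simp]: "prepend x 0 = 0"
  by (simp add: prepend_def)

lemma prepend_simps: "prepend x (a + b) = prepend x a + prepend x b" "prepend x (a - b) = prepend x a - prepend x b"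
  "prepend x (- a) = - prepend x a" "prepend x (frag_cmul k a) = frag_cmul k (prepend x a)"
  by (simp_all add: prepend_def lin_simps)

lemma lin_prepend: "lin f (prepend x c) = lin (\<lambda>l. f (x # l)) c"
  by (simp add: prepend_def lin_lin)

lemma prepend_lin: "prepend x (lin f c) = lin (\<lambda>l. prepend x (f l)) c"
  by (simp add: prepend_def lin_lin)

text \<open>
  The contracting homotopy of the augmented complex.
\<close>

lemma BD_prepend: "BD (prepend x c) = c - prepend x (BD c)"
  by (simp add: lin_prepend lin_fun_diff prepend_lin)

lemma BD_bd: "BD (bd l) = 0"
  by (induction l) (simp_all add: BD_prepend lin_simps)

lemma lin_bd_bd [simp]: "lin (\<lambda>m. lin f (bd m)) (bd l) = 0"
  using lin_lin[of f bd "bd l"] by (simp add: BD_bd)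

lemma push_of [simp]: "push f (frag_of l) = frag_of (map f l)"
  by (simp add: push_def)

lemma push_0 [simp]: "push f 0 = 0"
  by (simp add: push_def)

lemma push_simps: "push f (a + b) = push f a + push f b" "push f (a - b) = push f a - push f b"
  "push f (- a) = - push f a" "push f (frag_cmul k a) = frag_cmul k (push f a)"
  by (simp_all add: push_def lin_simps)

lemma push_prepend: "push f (prepend x c) = prepend (f x) (push f c)"
  by (simp add: push_def lin_prepend prepend_lin)

lemma push_lin: "push f (lin g c) = lin (\<lambda>l. push f (g l)) c"
  by (simp add: push_def lin_lin)

lemma lin_push: "lin g (push f c) = lin (\<lambda>l. g (map f l)) c"
  by (simp add: push_def lin_lin)

lemma push_bd: "push f (bd l) = bd (map f l)"
  by (induction l) (simp_all add: push_prepend push_simps)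

lemma push_BD: "push f (BD c) = BD (push f c)"
  by (simp add: push_lin lin_push push_bd)

lemma push_push: "push f (push g c) = push (f \<circ> g) c"
  by (simp add: push_def lin_lin)

lemma push_cong_chains:
  "c \<in> chains X n \<Longrightarrow> (\<And>x. x \<in> X \<Longrightarrow> f x = g x) \<Longrightarrow> push f c = push g c"
  unfolding push_def by (rule lin_cong_chains, assumption) (metis (no_types, lifting) mem_Collect_eq map_cong subsetD tuples_def)

lemma map_tuples: "l \<in> tuples X n \<Longrightarrow> f ` X \<subseteq> Y \<Longrightarrow> map f l \<in> tuples Y n"
  by (auto simp: tuples_def)

lemma prepend_chains: "x \<in> X \<Longrightarrow> c \<in> chains X n \<Longrightarrow> prepend x c \<in> chains X (Suc n)"
  unfolding prepend_def by (erule chains_lin) simp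

lemma push_chains: "c \<in> chains X n \<Longrightarrow> f ` X \<subseteq> Y \<Longrightarrow> push f c \<in> chains Y n"
  unfolding push_def by (erule chains_lin) (simp add: map_tuples)

lemma bd_chains: "l \<in> tuples X (Suc n) \<Longrightarrow> bd l \<in> chains X n"
proof (induction n arbitrary: l)
  case 0
  then show ?case by (auto elim!: tuples_SucE simp: tuples_0)
next
  case (Suc n)
  then obtain x l' where "l = x # l'" "x \<in> X" "l' \<in> tuples X (Suc n)" by (auto elim: tuples_SucE)
  then show ?case using Suc.IH by (auto intro!: prepend_chains)
qed

lemma BD_chains: "c \<in> chains X (Suc n) \<Longrightarrow> BD c \<in> chains X n"
  by (erule chains_lin) (rule bd_chains)

lemma tuples_length: "l \<in> tuples X n \<Longrightarrow> length l = n"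
  by (simp add: tuples_def)

text \<open>
  The method of acyclic models. A homotopy from \<open>A\<close> to zero is built degree by degree: \<open>A xs\<close>
  minus the homotopy on the boundary is a cycle, which is filled by the cone from a vertex \<open>p\<close>
  that depends on the first entry of \<open>xs\<close> only. As no choices are made, the homotopy is natural
  whenever \<open>A\<close> and \<open>p\<close> are, in particular equivariant. The explicit degree serves for
  termination.
\<close>

primrec htpy_aux :: "('a list \<Rightarrow> ('b list \<Rightarrow>\<^sub>0 int)) \<Rightarrow> ('a \<Rightarrow> 'b) \<Rightarrow> nat \<Rightarrow> 'a list \<Rightarrow> ('b list \<Rightarrow>\<^sub>0 int)"
where
  "htpy_aux A p 0 xs = 0"
| "htpy_aux A p (Suc n) xs = prepend (p (hd xs)) (A xs - lin (htpy_aux A p n) (bd xs))"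

definition htpy :: "('a list \<Rightarrow> ('b list \<Rightarrow>\<^sub>0 int)) \<Rightarrow> ('a \<Rightarrow> 'b) \<Rightarrow> 'a list \<Rightarrow> ('b list \<Rightarrow>\<^sub>0 int)" where
  "htpy A p xs = htpy_aux A p (length xs) xs"

lemma lin_htpy_aux: "c \<in> chains X n \<Longrightarrow> lin (htpy_aux A p n) c = lin (htpy A p) c"
  by (rule lin_cong_chains) (auto simp: htpy_def tuples_length)

lemma htpy_Nil [simp]: "htpy A p [] = 0"
  by (simp add: htpy_def)

lemma htpy_Cons: "htpy A p (x # xs) = prepend (p x) (A (x # xs) - lin (htpy A p) (bd (x # xs)))"
proof -
  have "bd (x # xs) \<in> chains (set (x # xs)) (length xs)"
    by (rule bd_chains) (simp add: tuples_def)
  from lin_htpy_aux[OF this, of A p] show ?thesis by (simp add: htpy_def del: bd.simps)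
qed

lemma htpy_boundary:
  assumes "\<And>xs. BD (A xs) = lin A (bd xs)" "A [] = 0"
  shows "BD (htpy A p xs) + lin (htpy A p) (bd xs) = A xs"
proof (induction xs rule: length_induct)
  case (1 xs)
  show ?case
  proof (cases xs)
    case Nil
    then show ?thesis by (simp add: assms)
  next
    case (Cons x l)
    have b: "bd xs \<in> chains UNIV (length l)"
      by (rule bd_chains) (simp add: Cons tuples_def)
    let ?T = "htpy A p"
    have "lin (\<lambda>l. BD (?T l)) (bd xs) = lin (\<lambda>l. A l - lin ?T (bd l)) (bd xs)"
    proof (rule lin_cong_chains[OF b])
      fix m :: "'a list" assume "m \<in> tuples UNIV (length l)"
      then have "length m < length xs" by (simp add: Cons tuples_def)
      with 1 have "BD (?T m) + lin ?T (bd m) = A m" by blast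
      then show "BD (?T m) = A m - lin ?T (bd m)" by (simp add: algebra_simps)
    qed
    also have "\<dots> = BD (A xs)"
      by (simp add: lin_fun_diff assms)
    finally have "BD (A xs - lin ?T (bd xs)) = 0"
      by (simp add: lin_simps lin_lin)
    then show ?thesis
      by (simp add: Cons htpy_Cons BD_prepend del: bd.simps)
  qed
qed

lemma htpy_natural:
  assumes A: "\<And>xs. set xs \<subseteq> X \<Longrightarrow> A (map f xs) = push g (A xs)"
    and p: "\<And>x. x \<in> X \<Longrightarrow> p (f x) = g (p x)"
  shows "set xs \<subseteq> X \<Longrightarrow> htpy A p (map f xs) = push g (htpy A p xs)"
proof (induction xs rule: length_induct)
  case (1 xs)
  show ?case
  proof (cases xs)
    case Nil
    then show ?thesis by simp
  next
    case (Cons x l)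
    have b: "bd xs \<in> chains X (length l)"
      by (rule bd_chains) (use 1 Cons in \<open>simp add: tuples_def\<close>)
    have "lin (htpy A p) (bd (map f xs)) = lin (\<lambda>l. htpy A p (map f l)) (bd xs)"
      by (simp add: push_bd[symmetric] lin_push)
    also have "\<dots> = push g (lin (htpy A p) (bd xs))"
      unfolding push_lin by (rule lin_cong_chains[OF b]) (use 1 Cons in \<open>auto simp: tuples_def\<close>)
    finally show ?thesis
      using 1(2) A[of xs] p[of x]
      by (simp add: Cons htpy_Cons push_prepend push_simps del: bd.simps)
  qed
qed

lemma htpy_chains:
  assumes A: "\<And>xs n. xs \<in> tuples X n \<Longrightarrow> A xs \<in> chains Y n" and p: "p ` X \<subseteq> Y"
  shows "xs \<in> tuples X n \<Longrightarrow> htpy A p xs \<in> chains Y (Suc n)"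
proof (induction n arbitrary: xs)
  case 0
  then show ?case by (simp add: tuples_0)
next
  case (Suc n)
  from Suc.prems obtain x l where x: "xs = x # l" "x \<in> X" "l \<in> tuples X n" by (rule tuples_SucE)
  have "lin (htpy A p) (bd xs) \<in> chains Y (Suc n)"
    by (rule chains_lin[OF bd_chains[OF Suc.prems]]) (rule Suc.IH)
  then show ?case
    using A[OF Suc.prems] p x(2) by (auto simp: x(1) htpy_Cons simp del: bd.simps intro!: prepend_chains)
qed

section \<open>Products of simplices and the diagonal\<close>

text \<open>
  A product of chains (the role of the Eilenberg-Zilber map), obtained by coning off the Leibniz
  formula. The products with a single point are prescribed separately: the cone would add
  degenerate simplices to them, and they must be the plain inclusions \<open>y \<mapsto> (x, y)\<close> and \<open>x \<mapsto> (x,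
  y)\<close> for the end terms of the diagonal to be the two factor homomorphisms.
\<close>

primrec ez_aux :: "nat \<Rightarrow> 'a list \<Rightarrow> 'b list \<Rightarrow> (('a \<times> 'b) list \<Rightarrow>\<^sub>0 int)" where
  "ez_aux 0 xs ys = 0"
| "ez_aux (Suc n) xs ys =
    (if xs = [] \<or> ys = [] then 0
     else if tl xs = [] then frag_of (map (Pair (hd xs)) ys)
     else if tl ys = [] then frag_of (map (\<lambda>x. (x, hd ys)) xs)
     else prepend (hd xs, hd ys)
       (lin (\<lambda>u. ez_aux n u ys) (bd xs) + sg (length xs - 1) (lin (\<lambda>v. ez_aux n xs v) (bd ys))))"

definition ez :: "'a list \<Rightarrow> 'b list \<Rightarrow> (('a \<times> 'b) list \<Rightarrow>\<^sub>0 int)" where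
  "ez xs ys = ez_aux (length xs + length ys) xs ys"

lemma ez_Nil [simp]: "ez [] ys = 0" "ez xs [] = 0"
  by (cases ys; simp add: ez_def) (cases xs; simp add: ez_def)

lemma ez_single1: "ys \<noteq> [] \<Longrightarrow> ez [x] ys = frag_of (map (Pair x) ys)"
  by (simp add: ez_def)

lemma ez_single2: "xs \<noteq> [] \<Longrightarrow> ez xs [y] = frag_of (map (\<lambda>x. (x, y)) xs)"
  by (cases xs; cases "tl xs") (auto simp: ez_def)

text \<open>
  The right hand side of the Leibniz formula.
\<close>

definition ez_bd :: "'a list \<Rightarrow> 'b list \<Rightarrow> (('a \<times> 'b) list \<Rightarrow>\<^sub>0 int)" where
  "ez_bd xs ys = lin (\<lambda>u. ez u ys) (bd xs) + sg (length xs - 1) (lin (ez xs) (bd ys))"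

lemma ez_prepend:
  assumes "length xs \<ge> 2" "length ys \<ge> 2"
  shows "ez xs ys = prepend (hd xs, hd ys) (ez_bd xs ys)"
proof -
  obtain a b l where x: "xs = a # b # l" using assms by (metis Suc_le_length_iff numeral_2_eq_2)
  obtain c d m where y: "ys = c # d # m" using assms by (metis Suc_le_length_iff numeral_2_eq_2)
  define n where "n = Suc (length l) + Suc (Suc (length m))"
  have n: "length xs + length ys = Suc n" by (simp add: x y n_def)
  have bx: "bd xs \<in> chains UNIV (Suc (length l))" and b_y: "bd ys \<in> chains UNIV (Suc (length m))"
    by (rule bd_chains; simp add: x y tuples_def)+
  have "lin (\<lambda>u. ez_aux n u ys) (bd xs) = lin (\<lambda>u. ez u ys) (bd xs)"
    by (rule lin_cong_chains[OF bx]) (simp add: ez_def tuples_def n_def y)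
  moreover have "lin (\<lambda>v. ez_aux n xs v) (bd ys) = lin (ez xs) (bd ys)"
    by (rule lin_cong_chains[OF b_y]) (simp add: ez_def tuples_def n_def x)
  moreover have "ez_aux (Suc n) xs ys = prepend (hd xs, hd ys)
      (lin (\<lambda>u. ez_aux n u ys) (bd xs) + sg (length xs - 1) (lin (\<lambda>v. ez_aux n xs v) (bd ys)))"
    by (simp add: x y)
  ultimately show ?thesis
    by (simp add: ez_def[of xs ys] n ez_bd_def)
qed

text \<open>
  The boundary in the augmented complex sees one term more than Leibniz, namely the augmentation
  of a product of two points. The proof reduces to the vanishing of the boundary of \<open>ez_bd\<close>,
  where the mixed terms cancel by their signs.
\<close>

lemma ez_boundary:
  assumes "xs \<noteq> []" "ys \<noteq> []"
  shows "BD (ez xs ys) = ez_bd xs ys + (if length xs = 1 \<and> length ys = 1 then frag_of [] else 0)"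
  using assms
proof (induction "length xs + length ys" arbitrary: xs ys rule: less_induct)
  case less
  consider x where "xs = [x]" | y where "ys = [y]" "length xs \<ge> 2" | "length xs \<ge> 2" "length ys \<ge> 2"
    using less.prems by (cases xs; cases "tl xs"; cases ys; cases "tl ys") auto
  then show ?case
  proof cases
    case (1 x)
    show ?thesis
    proof (cases "tl ys")
      case Nil
      then obtain y where "ys = [y]" using less.prems by (cases ys) auto
      then show ?thesis by (simp add: 1 ez_single1 ez_bd_def)
    next
      case (Cons y' l)
      then obtain y where y: "ys = y # y' # l" using less.prems by (cases ys) auto
      have "bd ys \<in> chains UNIV (Suc (length l))" by (rule bd_chains) (simp add: y tuples_def)
      then have "lin (ez [x]) (bd ys) = push (Pair x) (bd ys)"
        unfolding push_def by (rule lin_cong_chains) (auto simp: tuples_def intro!: ez_single1)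
      then show ?thesis
        using less.prems(2) by (simp add: 1 y ez_single1 ez_bd_def push_bd del: bd.simps)
          (simp add: push_bd)
    qed
  next
    case (2 y)
    then obtain a b l where x: "xs = a # b # l" by (metis Suc_le_length_iff numeral_2_eq_2)
    have "bd xs \<in> chains UNIV (Suc (length l))" by (rule bd_chains) (simp add: x tuples_def)
    then have "lin (\<lambda>u. ez u [y]) (bd xs) = push (\<lambda>x. (x, y)) (bd xs)"
      unfolding push_def by (rule lin_cong_chains) (auto simp: tuples_def intro!: ez_single2)
    then show ?thesis
      using ez_single2[of xs y] by (simp add: 2 x ez_bd_def push_bd del: bd.simps) simp
  next
    case 3
    then obtain a b l where x: "xs = a # b # l" by (metis Suc_le_length_iff numeral_2_eq_2)
    obtain c d m where y: "ys = c # d # m" using 3 by (metis Suc_le_length_iff numeral_2_eq_2)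
    have bx: "bd xs \<in> chains UNIV (Suc (length l))" and b_y: "bd ys \<in> chains UNIV (Suc (length m))"
      by (rule bd_chains; simp add: x y tuples_def)+
    have "lin (\<lambda>u. BD (ez u ys)) (bd xs) = lin (\<lambda>u. ez_bd u ys) (bd xs)"
    proof (rule lin_cong_chains[OF bx])
      fix u :: "'a list" assume "u \<in> tuples UNIV (Suc (length l))"
      then have "length u + length ys < length xs + length ys" "u \<noteq> []" by (auto simp: tuples_def x)
      from less.hyps[OF this less.prems(2)] show "BD (ez u ys) = ez_bd u ys" by (simp add: y)
    qed
    also have "\<dots> = lin (\<lambda>u. lin (\<lambda>u'. ez u' ys) (bd u) + sg (length l) (lin (ez u) (bd ys))) (bd xs)"
      by (rule lin_cong_chains[OF bx]) (simp add: ez_bd_def tuples_def)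
    finally have E1: "BD (lin (\<lambda>u. ez u ys) (bd xs)) = sg (length l) (lin (\<lambda>u. lin (ez u) (bd ys)) (bd xs))"
      by (simp add: lin_fun_simps lin_lin)
    have "lin (\<lambda>v. BD (ez xs v)) (bd ys) = lin (\<lambda>v. ez_bd xs v) (bd ys)"
    proof (rule lin_cong_chains[OF b_y])
      fix v :: "'b list" assume "v \<in> tuples UNIV (Suc (length m))"
      then have "length xs + length v < length xs + length ys" "v \<noteq> []" by (auto simp: tuples_def y)
      from less.hyps[OF this(1) less.prems(1) this(2)] show "BD (ez xs v) = ez_bd xs v" by (simp add: x)
    qed
    also have "\<dots> = lin (\<lambda>v. lin (\<lambda>u. ez u v) (bd xs)) (bd ys)"
      by (simp add: ez_bd_def lin_fun_simps)
    finally have E2: "BD (lin (ez xs) (bd ys)) = lin (\<lambda>u. lin (ez u) (bd ys)) (bd xs)"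
      by (simp add: lin_lin lin_swap[of ez])
    have "BD (ez_bd xs ys) = 0"
      unfolding ez_bd_def lin_simps E1 E2 by (simp add: x flip: frag_cmul_distrib)
    then show ?thesis
      using 3 by (simp add: ez_prepend BD_prepend)
  qed
qed

lemma ez_natural: "ez (map f xs) (map g ys) = push (map_prod f g) (ez xs ys)"
proof (induction "length xs + length ys" arbitrary: xs ys rule: less_induct)
  case less
  consider "xs = []" | "ys = []" | x where "xs = [x]" "ys \<noteq> []" | y where "ys = [y]" "xs \<noteq> []"
    | "length xs \<ge> 2" "length ys \<ge> 2"
    by (cases xs; cases "tl xs"; cases ys; cases "tl ys") auto
  then show ?case
  proof cases
    case 5
    then obtain a b l where x: "xs = a # b # l" by (metis Suc_le_length_iff numeral_2_eq_2)
    obtain c d m where y: "ys = c # d # m" using 5 by (metis Suc_le_length_iff numeral_2_eq_2)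
    have bx: "bd xs \<in> chains UNIV (Suc (length l))" and b_y: "bd ys \<in> chains UNIV (Suc (length m))"
      by (rule bd_chains; simp add: x y tuples_def)+
    have "lin (\<lambda>u. ez (map f u) (map g ys)) (bd xs) = lin (\<lambda>u. push (map_prod f g) (ez u ys)) (bd xs)"
      by (rule lin_cong_chains[OF bx]) (use less in \<open>auto simp: tuples_def x\<close>)
    moreover have "lin (\<lambda>v. ez (map f xs) (map g v)) (bd ys) = lin (\<lambda>v. push (map_prod f g) (ez xs v)) (bd ys)"
      by (rule lin_cong_chains[OF b_y]) (use less in \<open>auto simp: tuples_def y\<close>)
    ultimately have "ez_bd (map f xs) (map g ys) = push (map_prod f g) (ez_bd xs ys)"
      by (simp add: ez_bd_def push_simps push_lin lin_push flip: push_bd)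
    moreover have "hd (map f xs) = f (hd xs)" "hd (map g ys) = g (hd ys)" by (simp_all add: x y)
    ultimately show ?thesis using 5 by (simp add: ez_prepend push_prepend)
  qed (auto simp: ez_single1 ez_single2 intro!: arg_cong[of _ _ frag_of])
qed

lemma ez_chains:
  assumes "xs \<in> tuples X (Suc m)" "ys \<in> tuples Y (Suc n)"
  shows "ez xs ys \<in> chains (X \<times> Y) (Suc (m + n))"
  using assms
proof (induction "m + n" arbitrary: m n xs ys rule: less_induct)
  case less
  obtain a l where x: "xs = a # l" "a \<in> X" "l \<in> tuples X m" using less.prems(1) by (rule tuples_SucE)
  obtain c k where y: "ys = c # k" "c \<in> Y" "k \<in> tuples Y n" using less.prems(2) by (rule tuples_SucE)
  show ?case
  proof (cases "m = 0 \<or> n = 0")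
    case True
    then show ?thesis
      using x y by (auto simp: tuples_0 ez_single1 ez_single2 tuples_def)
  next
    case False
    then obtain m' n' where mn: "m = Suc m'" "n = Suc n'" by (metis not0_implies_Suc)
    have bx: "bd xs \<in> chains X (Suc m')" and b_y: "bd ys \<in> chains Y (Suc n')"
      using less.prems by (auto simp: mn intro!: bd_chains)
    have "lin (\<lambda>u. ez u ys) (bd xs) \<in> chains (X \<times> Y) (Suc (m' + n))"
      by (rule chains_lin[OF bx]) (rule less.hyps, use less.prems mn in auto)
    moreover have "lin (ez xs) (bd ys) \<in> chains (X \<times> Y) (Suc (m + n'))"
      by (rule chains_lin[OF b_y]) (use less.hyps[of m n'] less.prems mn in auto)
    ultimately have "ez_bd xs ys \<in> chains (X \<times> Y) (m + n)"
      by (auto simp: ez_bd_def mn)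
    moreover have "ez xs ys = prepend (hd xs, hd ys) (ez_bd xs ys)"
      by (rule ez_prepend) (use less.prems mn in \<open>auto simp: tuples_def\<close>)
    ultimately show ?thesis using x y by (auto intro!: prepend_chains)
  qed
qed

text \<open>
  The sum of \<open>E u v\<close> over all ways to cut \<open>xs\<close> at one of its entries into a front face \<open>u\<close> and a
  back face \<open>v\<close> that share this entry, i.e. the pairing of \<open>E\<close> with the Alexander-Whitney
  coproduct of \<open>xs\<close>.
\<close>

fun aw :: "('a list \<Rightarrow> 'a list \<Rightarrow> ('b \<Rightarrow>\<^sub>0 int)) \<Rightarrow> 'a list \<Rightarrow> ('b \<Rightarrow>\<^sub>0 int)" where
  "aw E [] = 0"
| "aw E (x # l) = E [x] (x # l) + aw (\<lambda>u v. E (x # u) v) l"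

lemma lin_aw: "lin f (aw E xs) = aw (\<lambda>u v. lin f (E u v)) xs"
  by (induction xs arbitrary: E) (simp_all add: lin_simps)

lemma aw_fun_add: "aw (\<lambda>u v. E u v + F u v) xs = aw E xs + aw F xs"
  by (induction xs arbitrary: E F) simp_all

lemma aw_fun_diff: "aw (\<lambda>u v. E u v - F u v) xs = aw E xs - aw F xs"
  by (induction xs arbitrary: E F) simp_all

lemma aw_fun_zero [simp]: "aw (\<lambda>u v. 0) xs = 0"
  by (induction xs) simp_all

lemma aw_map: "aw E (map f xs) = aw (\<lambda>u v. E (map f u) (map f v)) xs"
  by (induction xs arbitrary: E) simp_all

lemma aw_cong:
  assumes "\<And>us x vs. xs = us @ x # vs \<Longrightarrow> E (us @ [x]) (x # vs) = F (us @ [x]) (x # vs)"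
  shows "aw E xs = aw F xs"
  using assms
proof (induction xs arbitrary: E F)
  case (Cons y l)
  have "aw (\<lambda>u v. E (y # u) v) l = aw (\<lambda>u v. F (y # u) v) l"
    by (rule Cons.IH) (use Cons.prems[of "y # _"] in auto)
  then show ?case using Cons.prems[of "[]"] by simp
qed simp

lemma aw_chains:
  assumes "\<And>us x vs. xs = us @ x # vs \<Longrightarrow> E (us @ [x]) (x # vs) \<in> chains X n"
  shows "aw E xs \<in> chains X n"
  using assms
proof (induction xs arbitrary: E)
  case (Cons y l)
  have "aw (\<lambda>u v. E (y # u) v) l \<in> chains X n"
    by (rule Cons.IH) (use Cons.prems[of "y # _"] in auto)
  then show ?case using Cons.prems[of "[]"] by auto
qed simp

text \<open>
  The coproduct is a chain map: deleting the shared entry from the front face of one cut or from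
  the back face of the preceding one gives the same pair with opposite signs, so that only the
  two extreme terms, with an empty face, survive in addition.
\<close>

lemma aw_boundary:
  assumes "xs \<noteq> []"
  shows "aw (\<lambda>u v. lin (\<lambda>u'. E u' v) (bd u) + sg (length u - 1) (lin (E u) (bd v))) xs
    = lin (aw E) (bd xs) + E [] xs + sg (length xs - 1) (E xs [])"
  using assms
proof (induction xs arbitrary: E)
  case (Cons x l)
  show ?case
  proof (cases l)
    case Nil
    then show ?thesis by simp
  next
    case (Cons y k)
    define D where "D u v = lin (\<lambda>u'. E (x # u') v) (bd u) + sg (length u - 1) (lin (E (x # u)) (bd v))" for u v
    have IH: "aw D l = lin (aw (\<lambda>u v. E (x # u) v)) (bd l) + E [x] l + sg (length l - 1) (E (x # l) [])"
      unfolding D_def by (rule Cons.IH) (simp add: \<open>l = y # k\<close>)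
    have "aw (\<lambda>u v. lin (\<lambda>u'. E u' v) (bd (x # u)) + sg (length u) (lin (E (x # u)) (bd v))) l
      = aw (\<lambda>u v. E u v - D u v) l"
    proof (rule aw_cong)
      fix us z vs assume "l = us @ z # vs"
      show "lin (\<lambda>u'. E u' (z # vs)) (bd (x # us @ [z])) + sg (length (us @ [z])) (lin (E (x # us @ [z])) (bd (z # vs)))
        = E (us @ [z]) (z # vs) - D (us @ [z]) (z # vs)"
        by (simp add: D_def lin_simps lin_prepend del: bd.simps(2)) (simp add: lin_simps lin_prepend del: bd.simps(2) add: bd.simps(2)[of x])
    qed
    also have "\<dots> = aw E l - aw D l" by (rule aw_fun_diff)
    finally have *: "aw (\<lambda>u v. lin (\<lambda>u'. E u' v) (bd (x # u)) + sg (length u) (lin (E (x # u)) (bd v))) l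
      = aw E l - aw D l" .
    have bl: "lin (aw E) (bd (x # l)) = aw E l - lin (\<lambda>m. E [x] (x # m)) (bd l) - lin (aw (\<lambda>u v. E (x # u) v)) (bd l)"
      by (simp add: lin_simps lin_prepend lin_fun_add algebra_simps)
    have b2: "lin (E [x]) (bd (x # l)) = E [x] l - lin (\<lambda>m. E [x] (x # m)) (bd l)"
      by (simp add: lin_simps lin_prepend)
    have sgl: "sg (length l) (E (x # l) []) = - sg (length l - 1) (E (x # l) [])"
      by (simp add: \<open>l = y # k\<close>)
    show ?thesis
      using * IH by (simp add: bl b2 sgl del: bd.simps(2)) (simp add: algebra_simps)
  qed
qed simp

lemma aw_first: "aw (\<lambda>u v. if length u \<le> 1 then E u v else 0) (x # l) = E [x] (x # l)"
proof -
  have "aw (\<lambda>u v. if length (x # u) \<le> 1 then E (x # u) v else 0) l = aw (\<lambda>u v. 0) l"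
    by (rule aw_cong) simp
  then show ?thesis by simp
qed

lemma aw_last: "xs \<noteq> [] \<Longrightarrow> aw (\<lambda>u v. if length v \<le> 1 then E u v else 0) xs = E xs [last xs]"
proof (induction xs arbitrary: E)
  case (Cons x l)
  show ?case
    using Cons.IH[of "\<lambda>u. E (x # u)"] by (cases l) auto
qed simp

text \<open>
  The two extreme cuts, where one of the faces is a single point, are the parts of the diagonal
  that come from the two factors; the remaining sum consists of the cross terms.
\<close>

lemma aw_ends:
  assumes "length xs \<ge> 2"
  shows "aw E xs = E [hd xs] xs + E xs [last xs]
    + aw (\<lambda>u v. if length u \<le> 1 \<or> length v \<le> 1 then 0 else E u v) xs"
proof -
  obtain x l where x: "xs = x # l" "l \<noteq> []" using assms by (cases xs; cases "tl xs") auto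
  have "aw E xs = aw (\<lambda>u v. (if length u \<le> 1 then E u v else 0) +
      ((if length v \<le> 1 then if length u \<le> 1 then 0 else E u v else 0) +
      (if length u \<le> 1 \<or> length v \<le> 1 then 0 else E u v))) xs"
    by (rule aw_cong) simp
  also have "\<dots> = E [hd xs] xs + (E xs [last xs] +
      aw (\<lambda>u v. if length u \<le> 1 \<or> length v \<le> 1 then 0 else E u v) xs)"
  proof -
    have "aw (\<lambda>u v. if length u \<le> 1 then E u v else 0) xs = E [hd xs] xs"
      unfolding x(1) by (subst aw_first) simp
    moreover have "aw (\<lambda>u v. if length v \<le> 1 then if length u \<le> 1 then 0 else E u v else 0) xs = E xs [last xs]"
      by (subst aw_last) (use assms in auto)
    ultimately show ?thesis unfolding aw_fun_add by simp
  qed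
  finally show ?thesis by (simp add: add.assoc)
qed

text \<open>
  The case of the empty list makes this a map of augmented complexes, so that its difference to
  the diagonal vanishes in degree \<open>-1\<close>, as \<open>htpy_boundary\<close> requires.
\<close>

definition aw_ez :: "'a list \<Rightarrow> (('a \<times> 'a) list \<Rightarrow>\<^sub>0 int)" where
  "aw_ez xs = (if xs = [] then frag_of [] else aw ez xs)"

lemma aw_ez_boundary: "BD (aw_ez xs) = lin aw_ez (bd xs)"
proof -
  consider "xs = []" | x where "xs = [x]" | x y l where "xs = x # y # l"
    by (cases xs; cases "tl xs") auto
  then show ?thesis
  proof cases
    case 3
    have "BD (aw_ez xs) = aw (\<lambda>u v. BD (ez u v)) xs" by (simp add: aw_ez_def lin_aw 3 del: aw.simps)
    also have "\<dots> = aw (\<lambda>u v. lin (\<lambda>u'. ez u' v) (bd u) + sg (length u - 1) (lin (ez u) (bd v))) xs"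
    proof (rule aw_cong)
      fix us z vs assume "xs = us @ z # vs"
      then have "us \<noteq> [] \<or> vs \<noteq> []" using 3 by auto
      then show "BD (ez (us @ [z]) (z # vs)) = lin (\<lambda>u'. ez u' (z # vs)) (bd (us @ [z]))
          + sg (length (us @ [z]) - 1) (lin (ez (us @ [z])) (bd (z # vs)))"
        by (subst ez_boundary) (auto simp: ez_bd_def simp del: bd.simps)
    qed
    also have "\<dots> = lin (aw ez) (bd xs)" by (subst aw_boundary) (auto simp: 3 simp del: bd.simps)
    also have "\<dots> = lin aw_ez (bd xs)"
      by (rule lin_cong_chains[OF bd_chains[of xs UNIV "Suc (length l)"]])
        (auto simp: 3 tuples_def aw_ez_def simp del: aw.simps)
    finally show ?thesis .
  qed (simp_all add: aw_ez_def ez_single1)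
qed

lemma aw_ez_natural: "aw_ez (map f xs) = push (map_prod f f) (aw_ez xs)"
  by (simp add: aw_ez_def aw_map ez_natural push_def lin_aw)

lemma aw_ez_chains: "xs \<in> tuples X n \<Longrightarrow> aw_ez xs \<in> chains (X \<times> X) n"
proof (cases xs)
  case (Cons x l)
  assume xs: "xs \<in> tuples X n"
  have "aw ez xs \<in> chains (X \<times> X) n"
  proof (rule aw_chains)
    fix us z vs assume e: "xs = us @ z # vs"
    then have "n = Suc (length us + length vs)" "us @ [z] \<in> tuples X (Suc (length us))"
      "z # vs \<in> tuples X (Suc (length vs))" using xs by (auto simp: tuples_def)
    then show "ez (us @ [z]) (z # vs) \<in> chains (X \<times> X) n" using ez_chains by metis
  qed
  then show ?thesis by (simp add: aw_ez_def Cons)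
qed (auto simp: aw_ez_def tuples_def)

definition diag_htpy :: "'a list \<Rightarrow> (('a \<times> 'a) list \<Rightarrow>\<^sub>0 int)" where
  "diag_htpy = htpy (\<lambda>xs. frag_of (map (\<lambda>x. (x, x)) xs) - aw_ez xs) (\<lambda>x. (x, x))"

lemma diag_htpy_boundary:
  "BD (diag_htpy xs) + lin diag_htpy (bd xs) = frag_of (map (\<lambda>x. (x, x)) xs) - aw_ez xs"
  unfolding diag_htpy_def
proof (rule htpy_boundary)
  show "BD (frag_of (map (\<lambda>x. (x, x)) xs) - aw_ez xs)
      = lin (\<lambda>xs. frag_of (map (\<lambda>x. (x, x)) xs) - aw_ez xs) (bd xs)" for xs :: "'a list"
    by (simp add: lin_simps lin_fun_simps aw_ez_boundary push_bd[symmetric] push_def)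
qed (simp add: aw_ez_def)

lemma diag_htpy_natural:
  fixes f :: "'a \<Rightarrow> 'a"
  shows "diag_htpy (map f xs) = push (map_prod f f) (diag_htpy xs)"
  unfolding diag_htpy_def
  by (rule htpy_natural[where X = UNIV]) (auto simp: push_simps aw_ez_natural o_def)

lemma diag_htpy_chains: "xs \<in> tuples X n \<Longrightarrow> diag_htpy xs \<in> chains (X \<times> X) (Suc n)"
  unfolding diag_htpy_def
  by (rule htpy_chains[where X = X]) (auto intro!: chains_diff aw_ez_chains, auto simp: tuples_def)

section \<open>Chains modulo translation\<close>

context group
begin

text \<open>
  The bar complex is the complex of lists modulo left translation. Instead of forming the
  quotient, every list is moved to the representative that starts with the unit, and chains are
  compared after \<open>Nml\<close>.
\<close>

definition rebase :: "'a list \<Rightarrow> 'a list" where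
  "rebase xs = map (\<lambda>x. inv (hd xs) \<otimes> x) xs"

definition Nml :: "('a list \<Rightarrow>\<^sub>0 int) \<Rightarrow> ('a list \<Rightarrow>\<^sub>0 int)" where
  "Nml = lin (\<lambda>l. frag_of (rebase l))"

abbreviation act :: "'a \<Rightarrow> 'a list \<Rightarrow> 'a list" where
  "act g \<equiv> map (\<lambda>x. g \<otimes> x)"

lemma Nml_of [simp]: "Nml (frag_of l) = frag_of (rebase l)"
  by (simp add: Nml_def)

lemma Nml_0 [simp]: "Nml 0 = 0"
  by (simp add: Nml_def)

lemma Nml_simps: "Nml (a + b) = Nml a + Nml b" "Nml (a - b) = Nml a - Nml b"
  "Nml (- a) = - Nml a" "Nml (frag_cmul k a) = frag_cmul k (Nml a)"
  by (simp_all add: Nml_def lin_simps)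

lemma Nml_lin: "Nml (lin f c) = lin (\<lambda>l. Nml (f l)) c"
  by (simp add: Nml_def lin_lin)

lemma Nml_aw: "Nml (aw E xs) = aw (\<lambda>u v. Nml (E u v)) xs"
  by (simp add: Nml_def lin_aw)

lemma rebase_act:
  assumes "set xs \<subseteq> carrier G" "g \<in> carrier G"
  shows "rebase (act g xs) = rebase xs"
proof (cases xs)
  case (Cons x l)
  then have "inv (g \<otimes> x) \<otimes> (g \<otimes> y) = inv x \<otimes> y" if "y \<in> set xs" for y
  proof -
    have c: "x \<in> carrier G" "y \<in> carrier G" using assms that Cons by auto
    have "inv (g \<otimes> x) \<otimes> (g \<otimes> y) = inv x \<otimes> (inv g \<otimes> (g \<otimes> y))"
      using c assms by (simp add: inv_mult_group m_assoc)
    also have "inv g \<otimes> (g \<otimes> y) = y" using c assms by (simp add: m_assoc[symmetric])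
    finally show ?thesis .
  qed
  then show ?thesis by (auto simp: rebase_def Cons)
qed (simp add: rebase_def)

lemma rebase_eq_act: "rebase xs = act (inv (hd xs)) xs"
  by (simp add: rebase_def)

lemma tuples_hd: "xs \<in> tuples X n \<Longrightarrow> xs \<noteq> [] \<Longrightarrow> hd xs \<in> X"
  by (cases xs) (auto simp: tuples_def)

lemma act_tuples: "subgroup H G \<Longrightarrow> g \<in> H \<Longrightarrow> xs \<in> tuples H n \<Longrightarrow> act g xs \<in> tuples H n"
  by (auto simp: tuples_def subgroup.m_closed)

lemma rebase_tuples: "subgroup H G \<Longrightarrow> xs \<in> tuples H n \<Longrightarrow> rebase xs \<in> tuples H n"
  unfolding rebase_eq_act
  by (cases "xs = []") (auto simp: tuples_hd intro!: act_tuples subgroup.m_inv_closed)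

lemma Nml_push_act:
  assumes "c \<in> chains (carrier G) n" "g \<in> carrier G"
  shows "Nml (push (\<lambda>x. g \<otimes> x) c) = Nml c"
  unfolding Nml_def lin_push by (rule lin_cong_chains[OF assms(1)]) (use assms in \<open>simp add: rebase_act tuples_def\<close>)

text \<open>
  Translation invariant maps are well defined on the quotient by translations.
\<close>

lemma Nml_lin_dep:
  assumes K: "subgroup K G" and f: "\<And>l g. l \<in> tuples K n \<Longrightarrow> g \<in> K \<Longrightarrow> Nml (f (act g l)) = Nml (f l)"
    and c: "c \<in> chains K n" "c' \<in> chains K n" and eq: "Nml c = Nml c'"
  shows "Nml (lin f c) = Nml (lin f c')"
proof -
  have "Nml (lin f c) = Nml (lin f (Nml c))" if "c \<in> chains K n" for c
  proof -
    have "lin (\<lambda>l. Nml (f l)) c = lin (\<lambda>l. Nml (f (rebase l))) c"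
    proof (rule lin_cong_chains[OF that])
      fix l assume l: "l \<in> tuples K n"
      show "Nml (f l) = Nml (f (rebase l))"
      proof (cases "l = []")
        case False
        then have "inv (hd l) \<in> K" using tuples_hd[OF l] subgroup.m_inv_closed[OF K] by simp
        then show ?thesis using f[OF l] by (simp add: rebase_eq_act)
      qed (simp add: rebase_def)
    qed
    then show ?thesis by (simp add: Nml_lin) (simp add: Nml_def lin_lin)
  qed
  then show ?thesis using c eq by metis
qed

text \<open>
  A null-homotopy, through degree \<open>n\<close>, of the map that the inclusion of \<open>H\<close> into \<open>K\<close> induces on
  bar complexes in positive degrees, written on homogeneous lists (a list of length \<open>k + 1\<close> has
  degree \<open>k\<close>). In degree \<open>0\<close> the homotopy is zero; this is consistent, since the boundary from
  degree \<open>1\<close> to degree \<open>0\<close> of the bar complex with trivial coefficients vanishes.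
\<close>

definition null_htpy :: "nat \<Rightarrow> 'a set \<Rightarrow> 'a set \<Rightarrow> ('a list \<Rightarrow> ('a list \<Rightarrow>\<^sub>0 int)) \<Rightarrow> bool" where
  "null_htpy n H K h \<longleftrightarrow>
    (\<forall>u. length u \<le> 1 \<longrightarrow> h u = 0) \<and>
    (\<forall>k. \<forall>u \<in> tuples H k. h u \<in> chains K (Suc k)) \<and>
    (\<forall>g\<in>H. \<forall>u. set u \<subseteq> H \<longrightarrow> Nml (h (act g u)) = Nml (h u)) \<and>
    (\<forall>u. set u \<subseteq> H \<longrightarrow> 2 \<le> length u \<longrightarrow> length u \<le> Suc n \<longrightarrow>
       Nml (BD (h u)) + Nml (lin h (bd u)) = frag_of (rebase u))"

end

section \<open>One swindle gains one degree\<close>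

text \<open>
  The group \<open>M\<close> has room for a second copy \<open>b\<close> of \<open>H\<close> that commutes with all of \<open>K\<close> and that
  absorbs \<open>H\<close> up to conjugation. Three groups are needed since the null-homotopy that is to be
  improved maps chains of \<open>H\<close> to chains of \<open>K\<close>, and those have to be multiplied with \<open>b\<close>.
\<close>

locale swindle = group +
  fixes H K M b t
  assumes sub: "subgroup H G" "subgroup K G" "subgroup M G" and HK: "H \<subseteq> K" and KM: "K \<subseteq> M"
    and b_closed: "\<And>x. x \<in> H \<Longrightarrow> b x \<in> M"
    and b_mult: "\<And>x y. x \<in> H \<Longrightarrow> y \<in> H \<Longrightarrow> b (x \<otimes> y) = b x \<otimes> b y"
    and b_comm: "\<And>x y. x \<in> K \<Longrightarrow> y \<in> H \<Longrightarrow> x \<otimes> b y = b y \<otimes> x"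
    and t: "t \<in> M" "\<And>x. x \<in> H \<Longrightarrow> t \<otimes> b x = x \<otimes> b x \<otimes> t"
begin

lemma in_carrier [simp]: "x \<in> H \<Longrightarrow> x \<in> carrier G" "x \<in> K \<Longrightarrow> x \<in> carrier G"
  "x \<in> M \<Longrightarrow> x \<in> carrier G"
  using sub subgroup.mem_carrier by metis+

lemma b_carrier [simp]: "x \<in> H \<Longrightarrow> b x \<in> carrier G"
  using b_closed by simp

lemma HM: "x \<in> H \<Longrightarrow> x \<in> M"
  using HK KM by auto

lemma M_mult: "x \<in> M \<Longrightarrow> y \<in> M \<Longrightarrow> x \<otimes> y \<in> M"
  using sub subgroup.m_closed by metis

lemma H_mult: "x \<in> H \<Longrightarrow> y \<in> H \<Longrightarrow> x \<otimes> y \<in> H"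
  using sub subgroup.m_closed by metis

lemma H_inv: "x \<in> H \<Longrightarrow> inv x \<in> H"
  using sub subgroup.m_inv_closed by metis

lemma M_carrier: "M \<subseteq> carrier G" by auto

lemma chainsM: "c \<in> chains M n \<Longrightarrow> c \<in> chains (carrier G) n"
  using chains_mono[OF M_carrier] .

definition mu :: "'a \<times> 'a \<Rightarrow> 'a" where "mu p = fst p \<otimes> snd p"

text \<open>
  The Pontryagin product of a chain in \<open>K\<close> with a chain in the commuting copy \<open>b\<close> of \<open>H\<close>.
\<close>

definition dot :: "'a list \<Rightarrow> 'a list \<Rightarrow> ('a list \<Rightarrow>\<^sub>0 int)" where
  "dot u v = push mu (ez u (map b v))"

lemma dot_chains: "u \<in> tuples K (Suc i) \<Longrightarrow> v \<in> tuples H (Suc j) \<Longrightarrow> dot u v \<in> chains M (Suc (i + j))"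
  unfolding dot_def
  by (rule push_chains[OF ez_chains[of _ K _ _ "b ` H"]])
    (use KM in \<open>auto simp: mu_def M_mult b_closed intro!: map_tuples\<close>)

text \<open>
  This is where commutation is used: the two translations combine to one translation of the
  product.
\<close>

lemma dot_inv:
  assumes "set u \<subseteq> K" "set v \<subseteq> H" "g \<in> K" "k \<in> H"
  shows "Nml (dot (act g u) (act k v)) = Nml (dot u v)"
proof (cases "u = [] \<or> v = []")
  case True
  then show ?thesis by (auto simp: dot_def)
next
  case False
  then obtain i j where ij: "length u = Suc i" "length v = Suc j" by (cases u; cases v) auto
  then have u: "u \<in> tuples K (Suc i)" and v: "v \<in> tuples H (Suc j)" using assms by (auto simp: tuples_def)
  have e: "ez u (map b v) \<in> chains (K \<times> b ` H) (Suc (i + j))"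
    using u v by (intro ez_chains map_tuples) auto
  have "map b (act k v) = act (b k) (map b v)" using assms by (auto simp: b_mult)
  then have "dot (act g u) (act k v) = push mu (push (map_prod (\<lambda>x. g \<otimes> x) (\<lambda>x. b k \<otimes> x)) (ez u (map b v)))"
    by (simp add: dot_def ez_natural del: map_map)
  also have "\<dots> = push ((\<lambda>x. (g \<otimes> b k) \<otimes> x) \<circ> mu) (ez u (map b v))"
    unfolding push_push
  proof (rule push_cong_chains[OF e])
    fix p assume "p \<in> K \<times> b ` H"
    then obtain x y where p: "p = (x, b y)" "x \<in> K" "y \<in> H" by auto
    have "g \<otimes> x \<otimes> (b k \<otimes> b y) = g \<otimes> (x \<otimes> b k) \<otimes> b y" using p assms by (simp add: m_assoc)
    also have "x \<otimes> b k = b k \<otimes> x" using p assms by (simp add: b_comm)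
    also have "g \<otimes> (b k \<otimes> x) \<otimes> b y = g \<otimes> b k \<otimes> (x \<otimes> b y)" using p assms by (simp add: m_assoc)
    finally show "(mu \<circ> map_prod ((\<otimes>) g) ((\<otimes>) (b k))) p = ((\<otimes>) (g \<otimes> b k) \<circ> mu) p"
      by (simp add: p mu_def)
  qed
  also have "\<dots> = push (\<lambda>x. (g \<otimes> b k) \<otimes> x) (dot u v)" by (simp add: dot_def push_push)
  finally show ?thesis
    using Nml_push_act[OF chainsM[OF dot_chains[OF u v]], of "g \<otimes> b k"] assms by simp
qed

lemma one_H: "\<one> \<in> H" and one_K: "\<one> \<in> K"
  using sub subgroup.one_closed by auto

lemma act_one: "set u \<subseteq> K \<Longrightarrow> act \<one> u = u"
  by (auto intro!: map_idI)

lemma dot_inv1: "set u \<subseteq> K \<Longrightarrow> set v \<subseteq> H \<Longrightarrow> g \<in> K \<Longrightarrow> Nml (dot (act g u) v) = Nml (dot u v)"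
  using dot_inv[of u v g \<one>] act_one[of v] HK by (simp add: one_H)

lemma dot_inv2: "set u \<subseteq> K \<Longrightarrow> set v \<subseteq> H \<Longrightarrow> k \<in> H \<Longrightarrow> Nml (dot u (act k v)) = Nml (dot u v)"
  using dot_inv[of u v \<one> k] act_one[of u] by (simp add: one_K)

lemma dot_boundary:
  assumes "u \<noteq> []" "v \<noteq> []" "2 \<le> length u \<or> 2 \<le> length v"
  shows "BD (dot u v) = lin (\<lambda>u'. dot u' v) (bd u) + sg (length u - 1) (lin (dot u) (bd v))"
proof -
  have "BD (dot u v) = push mu (BD (ez u (map b v)))" unfolding dot_def push_BD ..
  also have "BD (ez u (map b v)) = ez_bd u (map b v)" using assms by (auto simp: ez_boundary)
  also have "push mu (ez_bd u (map b v)) = lin (\<lambda>u'. dot u' v) (bd u) + sg (length u - 1) (lin (dot u) (bd v))"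
    unfolding ez_bd_def push_simps push_lin push_bd[symmetric] lin_push dot_def ..
  finally show ?thesis .
qed

definition cross :: "'a list \<Rightarrow> ('a list \<Rightarrow>\<^sub>0 int)" where
  "cross = aw (\<lambda>u v. if length u \<le> 1 \<or> length v \<le> 1 then 0 else dot u v)"

definition mub :: "'a \<times> 'a \<Rightarrow> 'a" where "mub p = fst p \<otimes> b (snd p)"

definition absorbed :: "'a \<Rightarrow> 'a" where "absorbed x = x \<otimes> b x"

lemma absorbed_M: "x \<in> H \<Longrightarrow> absorbed x \<in> M"
  by (simp add: absorbed_def M_mult b_closed HM)

text \<open>
  \<open>absorbed\<close> is multiplicative because \<open>b\<close> commutes with \<open>H\<close>.
\<close>

lemma absorbed_mult: "g \<in> H \<Longrightarrow> x \<in> H \<Longrightarrow> absorbed (g \<otimes> x) = absorbed g \<otimes> absorbed x"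
proof -
  assume gx: "g \<in> H" "x \<in> H"
  have "absorbed (g \<otimes> x) = g \<otimes> (x \<otimes> b g) \<otimes> b x" using gx by (simp add: absorbed_def b_mult m_assoc)
  also have "x \<otimes> b g = b g \<otimes> x" using gx HK by (auto simp: b_comm)
  also have "g \<otimes> (b g \<otimes> x) \<otimes> b x = absorbed g \<otimes> absorbed x" using gx by (simp add: absorbed_def m_assoc)
  finally show ?thesis .
qed

lemma mub_act: "g \<in> H \<Longrightarrow> p \<in> H \<times> H \<Longrightarrow> mub (map_prod (\<lambda>x. g \<otimes> x) (\<lambda>x. g \<otimes> x) p) = absorbed g \<otimes> mub p"
proof -
  assume gx: "g \<in> H" "p \<in> H \<times> H"
  obtain x y where p: "p = (x, y)" "x \<in> H" "y \<in> H" using gx by auto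
  have "mub (map_prod (\<lambda>x. g \<otimes> x) (\<lambda>x. g \<otimes> x) p) = g \<otimes> (x \<otimes> b g) \<otimes> b y"
    using gx p by (simp add: mub_def b_mult m_assoc)
  also have "x \<otimes> b g = b g \<otimes> x" using gx p HK by (auto simp: b_comm)
  also have "g \<otimes> (b g \<otimes> x) \<otimes> b y = absorbed g \<otimes> mub p" using gx p by (simp add: absorbed_def mub_def m_assoc)
  finally show ?thesis .
qed

text \<open>
  The homotopy from the diagonal to its decomposition, pushed along \<open>(x, y) \<mapsto> x b y\<close>. It relates
  \<open>absorbed\<close> to the sum of \<open>b\<close>, the inclusion and the cross terms.
\<close>

definition diagpart :: "'a list \<Rightarrow> ('a list \<Rightarrow>\<^sub>0 int)" where
  "diagpart xs = push mub (diag_htpy xs)"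

lemma diagpart_chains: "xs \<in> tuples H n \<Longrightarrow> diagpart xs \<in> chains M (Suc n)"
  unfolding diagpart_def
  by (rule push_chains[OF diag_htpy_chains]) (auto simp: mub_def M_mult b_closed HM)

lemma diagpart_inv:
  assumes "xs \<in> tuples H n" "g \<in> H"
  shows "Nml (diagpart (act g xs)) = Nml (diagpart xs)"
proof -
  have "diagpart (act g xs) = push (mub \<circ> map_prod (\<lambda>x. g \<otimes> x) (\<lambda>x. g \<otimes> x)) (diag_htpy xs)"
    by (simp add: diagpart_def diag_htpy_natural push_push)
  also have "\<dots> = push ((\<lambda>x. absorbed g \<otimes> x) \<circ> mub) (diag_htpy xs)"
    by (rule push_cong_chains[OF diag_htpy_chains[OF assms(1)]]) (simp add: mub_act assms)
  finally show ?thesis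
    using Nml_push_act[OF chainsM[OF diagpart_chains[OF assms(1)]], of "absorbed g"] assms absorbed_M[of g]
    by (simp add: diagpart_def push_push)
qed

lemma rebase_b_act: "x \<in> carrier G \<Longrightarrow> set xs \<subseteq> H \<Longrightarrow> rebase (map (\<lambda>y. x \<otimes> b y) xs) = rebase (map b xs)"
  using rebase_act[of "map b xs" x] b_carrier by (force simp: o_def)

lemma diagpart_boundary:
  assumes "set xs \<subseteq> H" "2 \<le> length xs"
  shows "Nml (BD (diagpart xs)) + Nml (lin diagpart (bd xs)) =
    frag_of (rebase (map absorbed xs)) - (frag_of (rebase (map b xs)) + frag_of (rebase xs) + Nml (cross xs))"
proof -
  have ne: "xs \<noteq> []" using assms by auto
  have "BD (diagpart xs) + lin diagpart (bd xs) = push mub (BD (diag_htpy xs) + lin diag_htpy (bd xs))"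
    unfolding push_simps push_BD push_lin[of mub diag_htpy] by (simp add: diagpart_def[abs_def])
  also have "\<dots> = frag_of (map absorbed xs) - push mub (aw ez xs)"
    unfolding diag_htpy_boundary by (simp add: push_simps ne aw_ez_def o_def mub_def absorbed_def[abs_def])
  also have "push mub (aw ez xs) = aw dot xs"
  proof -
    have "push mub (ez u v) = dot u v" for u v
      using ez_natural[of id u b v] 
      by (simp add: dot_def push_push mu_def[abs_def] mub_def[abs_def] o_def)
    then show ?thesis by (simp add: push_def lin_aw)
  qed
  also have "\<dots> = dot [hd xs] xs + dot xs [last xs] + cross xs"
    unfolding cross_def by (rule aw_ends[OF assms(2)])
  finally have "Nml (BD (diagpart xs)) + Nml (lin diagpart (bd xs)) = frag_of (rebase (map absorbed xs))
      - (Nml (dot [hd xs] xs) + Nml (dot xs [last xs]) + Nml (cross xs))"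
    by (simp add: Nml_simps flip: Nml_simps(1))
  moreover have "Nml (dot [hd xs] xs) = frag_of (rebase (map b xs))"
    using ne assms rebase_b_act[of "hd xs" xs]
    by (simp add: dot_def ez_single1 mu_def o_def subsetD)
  moreover have "Nml (dot xs [last xs]) = frag_of (rebase xs)"
  proof -
    have l: "last xs \<in> H" using ne assms last_in_set by blast
    have e: "map (\<lambda>x. x \<otimes> b (last xs)) xs = act (b (last xs)) xs"
      using assms l HK by (auto intro: b_comm)
    have "dot xs [last xs] = frag_of (act (b (last xs)) xs)"
      using ne by (simp add: dot_def ez_single2 mu_def o_def flip: e)
    moreover have "set xs \<subseteq> carrier G" using assms by auto
    ultimately show ?thesis
      using l rebase_act[of xs "b (last xs)"] by simp
  qed
  ultimately show ?thesis by simp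
qed

text \<open>
  Right translation by \<open>t\<close> commutes with left translations and is homotopic to the identity.
  Applied to \<open>absorbed\<close> it gives \<open>b\<close> up to left translation, by the swindle equation.
\<close>

definition conjhtpy :: "'a list \<Rightarrow> ('a list \<Rightarrow>\<^sub>0 int)" where
  "conjhtpy = htpy (\<lambda>xs. frag_of (map (\<lambda>x. x \<otimes> t) xs) - frag_of xs) id"

lemma conjhtpy_chains: "xs \<in> tuples M n \<Longrightarrow> conjhtpy xs \<in> chains M (Suc n)"
  unfolding conjhtpy_def
  by (rule htpy_chains[where X = M]) (auto intro!: chains_diff map_tuples M_mult t)

lemma conjhtpy_inv:
  assumes "xs \<in> tuples M n" "g \<in> M"
  shows "Nml (conjhtpy (act g xs)) = Nml (conjhtpy xs)"
proof -
  have "conjhtpy (act g xs) = push (\<lambda>x. g \<otimes> x) (conjhtpy xs)"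
    unfolding conjhtpy_def
    by (rule htpy_natural[where X = M])
      (use assms t in \<open>auto simp: push_simps tuples_def m_assoc subset_iff intro!: arg_cong[of _ _ frag_of]\<close>)
  then show ?thesis
    using Nml_push_act[OF chainsM[OF conjhtpy_chains[OF assms(1)]], of g] assms by simp
qed

lemma conjhtpy_boundary:
  assumes "set xs \<subseteq> H"
  shows "Nml (BD (conjhtpy (map absorbed xs))) + Nml (lin (\<lambda>l. conjhtpy (map absorbed l)) (bd xs)) =
    frag_of (rebase (map b xs)) - frag_of (rebase (map absorbed xs))"
proof -
  have "BD (conjhtpy ys) + lin conjhtpy (bd ys) = frag_of (map (\<lambda>x. x \<otimes> t) ys) - frag_of ys" for ys
    unfolding conjhtpy_def
    by (rule htpy_boundary) (simp_all add: lin_simps lin_fun_simps push_def flip: push_bd)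
  from this[of "map absorbed xs"]
  have "BD (conjhtpy (map absorbed xs)) + lin (\<lambda>l. conjhtpy (map absorbed l)) (bd xs)
      = frag_of (map (\<lambda>x. absorbed x \<otimes> t) xs) - frag_of (map absorbed xs)"
    by (simp add: lin_push o_def flip: push_bd)
  also have "map (\<lambda>x. absorbed x \<otimes> t) xs = act t (map b xs)"
    using assms t by (auto simp: absorbed_def)
  finally have "Nml (BD (conjhtpy (map absorbed xs))) + Nml (lin (\<lambda>l. conjhtpy (map absorbed l)) (bd xs))
      = frag_of (rebase (act t (map b xs))) - frag_of (rebase (map absorbed xs))"
    by (simp add: Nml_simps flip: Nml_simps(1) del: map_map)
  moreover have "set (map b xs) \<subseteq> carrier G" using assms b_carrier by auto
  ultimately show ?thesis
    using rebase_act[of "map b xs" t] t by simp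
qed

text \<open>
  Here the induction hypothesis enters: the null-homotopy \<open>h\<close> is applied to the first factors of
  the cross terms. In degree \<open>n + 1\<close> these have degree at most \<open>n\<close>, because the second factors
  have positive degree.
\<close>

context
  fixes n h assumes h: "null_htpy n H K h"
begin

lemma h0: "length u \<le> 1 \<Longrightarrow> h u = 0" and h_chains: "u \<in> tuples H k \<Longrightarrow> h u \<in> chains K (Suc k)"
  and h_inv: "g \<in> H \<Longrightarrow> set u \<subseteq> H \<Longrightarrow> Nml (h (act g u)) = Nml (h u)"
  and h_bd: "set u \<subseteq> H \<Longrightarrow> 2 \<le> length u \<Longrightarrow> length u \<le> Suc n \<Longrightarrow>
       Nml (BD (h u)) + Nml (lin h (bd u)) = frag_of (rebase u)"
  using h unfolding null_htpy_def by blast+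

definition crossterm :: "'a list \<Rightarrow> 'a list \<Rightarrow> ('a list \<Rightarrow>\<^sub>0 int)" where
  "crossterm u v = (if length v \<le> 1 then 0 else lin (\<lambda>w. dot w v) (h u))"

lemma dot_dep:
  assumes "c \<in> chains K i" "c' \<in> chains K i" "Nml c = Nml c'" "set v \<subseteq> H"
  shows "Nml (lin (\<lambda>w. dot w v) c) = Nml (lin (\<lambda>w. dot w v) c')"
  by (rule Nml_lin_dep[OF sub(2) _ assms(1-3)]) (use assms in \<open>auto simp: tuples_def intro!: dot_inv1\<close>)

text \<open>
  The Leibniz formula for \<open>dot\<close> and the homotopy equation for \<open>h\<close>. Back faces of length \<open>2\<close> need
  care: their boundary is a difference of two points, which gives zero only after \<open>Nml\<close>.
\<close>

lemma crossterm_boundary: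
  assumes u: "set u \<subseteq> H" "u \<noteq> []" and v: "set v \<subseteq> H" "v \<noteq> []" and l: "length u + length v \<le> n + 3"
  shows "Nml (BD (crossterm u v)) = Nml ((if length u \<le> 1 \<or> length v \<le> 1 then 0 else dot u v)
      - (lin (\<lambda>u'. crossterm u' v) (bd u) + sg (length u - 1) (lin (crossterm u) (bd v))))"
proof -
  consider y where "v = [y]" | x where "u = [x]" "2 \<le> length v" | "2 \<le> length u" "2 \<le> length v"
    using u v by (cases u; cases "tl u"; cases v; cases "tl v") auto
  then show ?thesis
  proof cases
    case 1
    then show ?thesis by (simp add: crossterm_def)
  next
    case 2
    then have "crossterm u = (\<lambda>v. 0)" "crossterm [] = (\<lambda>v. 0)" by (simp_all add: crossterm_def h0 fun_eq_iff)
    then show ?thesis using 2 by simp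
  next
    case 3
    obtain k where k: "length u = Suc (Suc k)" using 3(1) by (metis le_Suc_ex numeral_2_eq_2 add_Suc)
    obtain j where j: "length v = Suc (Suc j)" using 3(2) by (metis le_Suc_ex numeral_2_eq_2 add_Suc)
    have ut: "u \<in> tuples H (Suc (Suc k))" and vt: "v \<in> tuples H (Suc (Suc j))"
      using u v k j by (simp_all add: tuples_def)
    have hu: "h u \<in> chains K (Suc (Suc (Suc k)))" by (rule h_chains[OF ut])
    have "BD (crossterm u v) = lin (\<lambda>w. BD (dot w v)) (h u)"
      using 3 by (simp add: crossterm_def lin_lin)
    also have "\<dots> = lin (\<lambda>w. lin (\<lambda>u'. dot u' v) (bd w) + sg (length u) (lin (dot w) (bd v))) (h u)"
      by (rule lin_cong_chains[OF hu]) (subst dot_boundary, use 3 k in \<open>auto simp: tuples_def\<close>)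
    finally have 0: "BD (crossterm u v) = lin (\<lambda>u'. dot u' v) (BD (h u))
        - sg (length u - 1) (lin (\<lambda>w. lin (dot w) (bd v)) (h u))"
      by (simp add: lin_fun_simps lin_lin k)
    have 1: "Nml (lin (\<lambda>u'. dot u' v) (BD (h u))) = Nml (dot u v) - Nml (lin (\<lambda>u'. crossterm u' v) (bd u))"
    proof -
      have lh: "lin h (bd u) \<in> chains K (Suc (Suc k))"
        by (rule chains_lin[OF bd_chains[OF ut]]) (rule h_chains)
      have "Nml (BD (h u)) + Nml (lin h (bd u)) = frag_of (rebase u)"
        by (rule h_bd) (use u l 3 in auto)
      then have "Nml (BD (h u)) = Nml (frag_of u - lin h (bd u))"
        by (simp add: Nml_simps algebra_simps)
      then have "Nml (lin (\<lambda>u'. dot u' v) (BD (h u))) = Nml (lin (\<lambda>u'. dot u' v) (frag_of u - lin h (bd u)))"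
        by (intro dot_dep[where i = "Suc (Suc k)"] BD_chains hu chains_diff lh)
          (use v tuples_mono[OF HK ut] in auto)
      also have "lin (\<lambda>u'. dot u' v) (lin h (bd u)) = lin (\<lambda>u'. crossterm u' v) (bd u)"
        using 3 by (simp add: lin_lin crossterm_def)
      then have "Nml (lin (\<lambda>u'. dot u' v) (frag_of u - lin h (bd u))) = Nml (dot u v) - Nml (lin (\<lambda>u'. crossterm u' v) (bd u))"
        by (simp add: lin_simps Nml_simps)
      finally show ?thesis .
    qed
    have 2: "Nml (lin (\<lambda>w. lin (dot w) (bd v)) (h u)) = Nml (lin (crossterm u) (bd v))"
    proof (cases j)
      case 0
      then obtain y z where yz: "v = [y, z]" using j by (cases v; cases "tl v") auto
      have yH: "y \<in> H" "z \<in> H" using v yz by auto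
      have "lin (\<lambda>w. Nml (dot w [z])) (h u) = lin (\<lambda>w. Nml (dot w [y])) (h u)"
      proof (rule lin_cong_chains[OF hu])
        fix w assume "w \<in> tuples K (Suc (Suc (Suc k)))"
        then have w: "set w \<subseteq> K" by (simp add: tuples_def)
        have "act (z \<otimes> inv y) [y] = [z]" using yH by (simp add: m_assoc)
        then show "Nml (dot w [z]) = Nml (dot w [y])"
          using dot_inv2[OF w, of "[y]" "z \<otimes> inv y"] yH H_mult H_inv by simp
      qed
      moreover have "crossterm u [z] = 0" "crossterm u [y] = 0" by (simp_all add: crossterm_def)
      ultimately show ?thesis
        by (simp add: yz lin_simps lin_fun_simps Nml_simps Nml_lin)
    next
      case (Suc j')
      have "lin (\<lambda>w. lin (dot w) (bd v)) (h u) = lin (\<lambda>v'. lin (\<lambda>w. dot w v') (h u)) (bd v)"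
        by (rule lin_swap)
      also have "\<dots> = lin (crossterm u) (bd v)"
        by (rule lin_cong_chains[OF bd_chains[OF vt]]) (use Suc in \<open>auto simp: crossterm_def tuples_def\<close>)
      finally show ?thesis by simp
    qed
    show ?thesis
      using 3 unfolding 0 by (simp add: Nml_simps 1 2)
  qed
qed

definition crosshtpy :: "'a list \<Rightarrow> ('a list \<Rightarrow>\<^sub>0 int)" where "crosshtpy = aw crossterm"

lemma crosshtpy_boundary:
  assumes "set xs \<subseteq> H" "2 \<le> length xs" "length xs \<le> n + 2"
  shows "Nml (BD (crosshtpy xs)) + Nml (lin crosshtpy (bd xs)) = Nml (cross xs)"
proof -
  have z: "crossterm [] xs = 0" "crossterm xs [] = 0" by (simp_all add: crossterm_def h0)
  have "Nml (BD (crosshtpy xs)) = aw (\<lambda>u v. Nml (BD (crossterm u v))) xs"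
    by (simp add: crosshtpy_def lin_aw Nml_aw)
  also have "\<dots> = aw (\<lambda>u v. Nml ((if length u \<le> 1 \<or> length v \<le> 1 then 0 else dot u v)
      - (lin (\<lambda>u'. crossterm u' v) (bd u) + sg (length u - 1) (lin (crossterm u) (bd v))))) xs"
    by (rule aw_cong) (rule crossterm_boundary; use assms in auto)
  also have "\<dots> = Nml (cross xs) - Nml (lin crosshtpy (bd xs))"
    unfolding Nml_aw[symmetric] aw_fun_diff cross_def
    by (subst aw_boundary) (use assms z in \<open>auto simp: Nml_simps crosshtpy_def\<close>)
  finally show ?thesis by simp
qed

lemma crosshtpy_inv:
  assumes "set xs \<subseteq> H" "g \<in> H"
  shows "Nml (crosshtpy (act g xs)) = Nml (crosshtpy xs)"
  unfolding crosshtpy_def Nml_aw aw_map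
proof (rule aw_cong)
  fix us x vs assume xs: "xs = us @ x # vs"
  define u v where uv: "u = us @ [x]" "v = x # vs"
  have s: "set u \<subseteq> H" "set v \<subseteq> H" using assms xs by (auto simp: uv)
  have hg: "h (act g u) \<in> chains K (Suc (length u))" "h u \<in> chains K (Suc (length u))"
    by (rule h_chains, use s assms H_mult in \<open>auto simp: tuples_def\<close>)+
  have "Nml (lin (\<lambda>w. dot w (act g v)) (h (act g u))) = Nml (lin (\<lambda>w. dot w v) (h (act g u)))"
    unfolding Nml_lin by (rule lin_cong_chains[OF hg(1)]) (use s assms in \<open>auto simp: tuples_def intro!: dot_inv2\<close>)
  also have "\<dots> = Nml (lin (\<lambda>w. dot w v) (h u))"
    by (rule dot_dep[OF hg]) (use s assms h_inv in auto)
  finally have "Nml (crossterm (act g u) (act g v)) = Nml (crossterm u v)" by (simp add: crossterm_def)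
  then show "Nml (crossterm (act g (us @ [x])) (act g (x # vs))) = Nml (crossterm (us @ [x]) (x # vs))" by (simp add: uv)
qed

lemma crosshtpy_chains: "xs \<in> tuples H k \<Longrightarrow> crosshtpy xs \<in> chains M (Suc k)"
  unfolding crosshtpy_def
proof (rule aw_chains)
  fix us x vs assume xs: "xs \<in> tuples H k" "xs = us @ x # vs"
  have hu: "h (us @ [x]) \<in> chains K (Suc (Suc (length us)))"
    by (rule h_chains) (use xs in \<open>auto simp: tuples_def\<close>)
  have v: "x # vs \<in> tuples H (Suc (length vs))" and k: "k = Suc (length us + length vs)"
    using xs by (auto simp: tuples_def)
  have "lin (\<lambda>w. dot w (x # vs)) (h (us @ [x])) \<in> chains M (Suc (Suc (length us) + length vs))"
    by (rule chains_lin[OF hu]) (rule dot_chains[OF _ v])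
  then show "crossterm (us @ [x]) (x # vs) \<in> chains M (Suc k)" by (simp add: crossterm_def k)
qed

text \<open>
  The three homotopies add up: \<open>conjhtpy\<close> contributes \<open>b\<close> minus \<open>absorbed\<close>, \<open>diagpart\<close>
  contributes \<open>absorbed\<close> minus \<open>b\<close> minus the inclusion minus the cross terms, and \<open>crosshtpy\<close>
  the cross terms. Hence minus their sum is a null-homotopy of the inclusion.
\<close>

theorem null_htpy_step: "\<exists>h'. null_htpy (Suc n) H M h'"
proof -
  define h2 where "h2 xs = - conjhtpy (map absorbed xs) - crosshtpy xs - diagpart xs" for xs
  define h' where "h' xs = (if length xs \<le> 1 then 0 else h2 xs)" for xs :: "'a list"
  have inv: "Nml (h2 (act g xs)) = Nml (h2 xs)" if g: "g \<in> H" and xs: "set xs \<subseteq> H" for g xs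
  proof -
    have xt: "xs \<in> tuples H (length xs)" using xs by (simp add: tuples_def)
    have "map absorbed (act g xs) = act (absorbed g) (map absorbed xs)" using g xs by (auto simp: absorbed_mult)
    moreover have "map absorbed xs \<in> tuples M (length xs)" by (rule map_tuples[OF xt]) (auto simp: absorbed_M)
    ultimately have "Nml (conjhtpy (map absorbed (act g xs))) = Nml (conjhtpy (map absorbed xs))"
      using conjhtpy_inv absorbed_M[OF g] by metis
    then show ?thesis
      using crosshtpy_inv[OF xs g] diagpart_inv[OF xt g] by (simp add: h2_def Nml_simps)
  qed
  have "Nml (BD (h' xs)) + Nml (lin h' (bd xs)) = frag_of (rebase xs)"
    if xs: "set xs \<subseteq> H" and l: "2 \<le> length xs" "length xs \<le> Suc (Suc n)" for xs
  proof -
    have "Nml (lin h' (bd xs)) = Nml (lin h2 (bd xs))"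
    proof (cases "length xs = 2")
      case True
      then obtain x y where xy: "xs = [x, y]" by (cases xs; cases "tl xs") auto
      have yH: "x \<in> H" "y \<in> H" using xs xy by auto
      have "act (y \<otimes> inv x) [x] = [y]" using yH by (simp add: m_assoc)
      then have "Nml (h2 [y]) = Nml (h2 [x])"
        using inv[of "y \<otimes> inv x" "[x]"] yH H_mult H_inv by simp
      then show ?thesis by (simp add: xy lin_simps Nml_simps h'_def)
    next
      case False
      then obtain k where "length xs = Suc (Suc (Suc k))" using l by (metis One_nat_def Suc_1 le_Suc_ex add_Suc_right add_0_right not0_implies_Suc add_Suc)
      then have xt: "xs \<in> tuples H (Suc (Suc (Suc k)))" using xs by (simp add: tuples_def)
      have "lin h' (bd xs) = lin h2 (bd xs)"
        by (rule lin_cong_chains[OF bd_chains[OF xt]]) (simp add: h'_def tuples_def)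
      then show ?thesis by simp
    qed
    moreover have "Nml (BD (h' xs)) = Nml (BD (h2 xs))" using l by (simp add: h'_def)
    moreover have h2: "h2 = (\<lambda>xs. - conjhtpy (map absorbed xs) - crosshtpy xs - diagpart xs)" by (simp add: h2_def fun_eq_iff)
    ultimately have "Nml (BD (h' xs)) + Nml (lin h' (bd xs))
      = - (Nml (BD (conjhtpy (map absorbed xs))) + Nml (lin (\<lambda>l. conjhtpy (map absorbed l)) (bd xs)))
        - (Nml (BD (crosshtpy xs)) + Nml (lin crosshtpy (bd xs))) - (Nml (BD (diagpart xs)) + Nml (lin diagpart (bd xs)))"
      by (simp add: lin_simps lin_fun_simps Nml_simps)
    also have "\<dots> = frag_of (rebase xs)"
      unfolding conjhtpy_boundary[OF xs] crosshtpy_boundary[OF xs l(1) l(2)[folded add_2_eq_Suc']] diagpart_boundary[OF xs l(1)] by simp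
    finally show ?thesis .
  qed
  moreover have "h' u \<in> chains M (Suc k)" if u: "u \<in> tuples H k" for u k
  proof -
    have "map absorbed u \<in> tuples M k" by (rule map_tuples[OF u]) (auto simp: absorbed_M)
    then show ?thesis
      using crosshtpy_chains[OF u] diagpart_chains[OF u]
      by (auto simp: h'_def h2_def intro!: chains_diff chains_minus conjhtpy_chains)
  qed
  ultimately have "null_htpy (Suc n) H M h'"
    using inv by (auto simp: null_htpy_def h'_def)
  then show ?thesis by blast
qed

end

end

section \<open>Acyclicity of groups with a tower of swindles\<close>

text \<open>
  The homomorphisms \<open>b n\<close> and the elements \<open>t n\<close> are part of the data, rather than chosen for
  each subgroup, so that the structure passes to all subgroups of \<open>G\<close> that are closed under the
  \<open>b n\<close> and contain the \<open>t n\<close>.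
\<close>

definition swindle_tower ::
  "('a, 'c) monoid_scheme \<Rightarrow> (nat \<Rightarrow> 'a set) \<Rightarrow> (nat \<Rightarrow> 'a \<Rightarrow> 'a) \<Rightarrow> (nat \<Rightarrow> 'a) \<Rightarrow> bool" where
  "swindle_tower G H b t \<longleftrightarrow> (\<Union>n. H n) = carrier G \<and>
    (\<forall>n. subgroup (H n) G \<and> H n \<subseteq> H (Suc n) \<and> b n ` H n \<subseteq> H (Suc n) \<and> t n \<in> H (Suc n)) \<and>
    (\<forall>n. \<forall>x\<in>H n. \<forall>y\<in>H n.
       b n (x \<otimes>\<^bsub>G\<^esub> y) = b n x \<otimes>\<^bsub>G\<^esub> b n y \<and> x \<otimes>\<^bsub>G\<^esub> b n y = b n y \<otimes>\<^bsub>G\<^esub> x) \<and>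
    (\<forall>n. \<forall>x\<in>H n. t n \<otimes>\<^bsub>G\<^esub> b n x = x \<otimes>\<^bsub>G\<^esub> b n x \<otimes>\<^bsub>G\<^esub> t n)"

lemma bd_sum: "bd xs = (\<Sum>i<length xs. sg i (frag_of (take i xs @ drop (Suc i) xs)))"
proof (induction xs)
  case (Cons x l)
  have c: "prepend x (sum f {..<n}) = (\<Sum>i<n. prepend x (f i))" for f and n :: nat
    by (induction n) (simp_all add: prepend_simps)
  show ?case
    by (simp add: Cons.IH c prepend_simps sum.lessThan_Suc_shift sum_negf[symmetric] del: sum.lessThan_Suc)
qed simp

context group
begin

lemma cancel: "x \<in> carrier G \<Longrightarrow> y \<in> carrier G \<Longrightarrow> x \<otimes> (inv x \<otimes> y) = y"
  "x \<in> carrier G \<Longrightarrow> y \<in> carrier G \<Longrightarrow> inv x \<otimes> (x \<otimes> y) = y"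
  by (simp_all add: m_assoc[symmetric])

text \<open>
  The passage from homogeneous lists to bar tuples and back: \<open>ratios\<close> identifies lists modulo
  translation with bar tuples, and \<open>partials \<one>\<close> is the inverse, with values in the lists that
  start with the unit.
\<close>

fun ratios :: "'a list \<Rightarrow> 'a list" where
  "ratios (x # y # l) = inv x \<otimes> y # ratios (y # l)"
| "ratios _ = []"

fun partials :: "'a \<Rightarrow> 'a list \<Rightarrow> 'a list" where
  "partials x [] = [x]"
| "partials x (g # u) = x # partials (x \<otimes> g) u"

definition tobar :: "('a list \<Rightarrow>\<^sub>0 int) \<Rightarrow> ('a list \<Rightarrow>\<^sub>0 int)" where
  "tobar = lin (\<lambda>l. frag_of (ratios l))"

lemma length_ratios [simp]: "length (ratios xs) = length xs - 1"
  by (induction xs rule: ratios.induct) auto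

lemma nth_ratios: "Suc k < length xs \<Longrightarrow> ratios xs ! k = inv (xs ! k) \<otimes> xs ! Suc k"
  by (induction xs arbitrary: k rule: ratios.induct) (auto simp: nth_Cons split: nat.split)

lemma ratios_tuples: "subgroup H G \<Longrightarrow> xs \<in> tuples H n \<Longrightarrow> ratios xs \<in> tuples H (n - 1)"
proof -
  assume H: "subgroup H G" "xs \<in> tuples H n"
  have "set (ratios xs) \<subseteq> H" if "set xs \<subseteq> H" using that
    by (induction xs rule: ratios.induct)
      (simp_all add: subgroup.m_closed[OF H(1)] subgroup.m_inv_closed[OF H(1)])
  then show ?thesis using H by (auto simp: tuples_def)
qed

lemma partials_hd [simp]: "partials x u \<noteq> []" "hd (partials x u) = x"
  by (cases u; simp)+

lemma ratios_partials: "x \<in> carrier G \<Longrightarrow> set u \<subseteq> carrier G \<Longrightarrow> ratios (partials x u) = u"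
proof (induction u arbitrary: x)
  case (Cons g u)
  have "ratios (x # l) = inv x \<otimes> hd l # ratios l" if "l \<noteq> []" for l
    using that by (cases l) auto
  then show ?case using Cons by (simp add: cancel)
qed simp

lemma partials_ratios: "xs \<noteq> [] \<Longrightarrow> set xs \<subseteq> carrier G \<Longrightarrow> partials (hd xs) (ratios xs) = xs"
  by (induction xs rule: ratios.induct) (simp_all add: cancel)

lemma partials_tuples: "subgroup H G \<Longrightarrow> x \<in> H \<Longrightarrow> u \<in> tuples H n \<Longrightarrow> partials x u \<in> tuples H (Suc n)"
  by (induction u arbitrary: x n) (auto simp: tuples_def subgroup.m_closed)

lemma ratios_rebase: "set xs \<subseteq> carrier G \<Longrightarrow> ratios (rebase xs) = ratios xs"
proof (rule nth_equalityI)
  fix k assume xs: "set xs \<subseteq> carrier G" and "k < length (ratios (rebase xs))"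
  then have k: "Suc k < length xs" by (simp add: rebase_def)
  then have "xs \<noteq> []" by auto
  then have c: "hd xs \<in> carrier G" "xs ! k \<in> carrier G" "xs ! Suc k \<in> carrier G"
    using xs k hd_in_set nth_mem Suc_lessD by blast+
  have "inv (inv (hd xs) \<otimes> xs ! k) \<otimes> (inv (hd xs) \<otimes> xs ! Suc k)
      = inv (xs ! k) \<otimes> (hd xs \<otimes> inv (hd xs)) \<otimes> xs ! Suc k"
    using c by (simp add: inv_mult_group m_assoc cancel)
  also have "\<dots> = inv (xs ! k) \<otimes> xs ! Suc k" using c by simp
  finally show "ratios (rebase xs) ! k = ratios xs ! k"
    using k nth_ratios[of k xs] nth_ratios[of k "rebase xs"] by (simp add: rebase_def)
qed (simp add: rebase_def)

lemma rebase_eq_partials: "xs \<noteq> [] \<Longrightarrow> set xs \<subseteq> carrier G \<Longrightarrow> rebase xs = partials \<one> (ratios xs)"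
proof -
  assume xs: "xs \<noteq> []" "set xs \<subseteq> carrier G"
  then have "rebase xs \<noteq> []" "set (rebase xs) \<subseteq> carrier G" "hd (rebase xs) = \<one>"
    by (auto simp: rebase_def hd_map dest: hd_in_set)
  then show ?thesis using partials_ratios[of "rebase xs"] ratios_rebase[OF xs(2)] by simp
qed

lemma bar_face_ratios:
  assumes "length xs = Suc (Suc n)" "i \<le> Suc n" "set xs \<subseteq> carrier G"
  shows "bar_face G i (ratios xs) = ratios (take i xs @ drop (Suc i) xs)"
proof (rule nth_equalityI)
  have l: "length (ratios xs) = Suc n" using assms by simp
  have ld: "length (take i xs @ drop (Suc i) xs) = Suc n" using assms by simp
  show "length (bar_face G i (ratios xs)) = length (ratios (take i xs @ drop (Suc i) xs))"
    using length_bar_face[OF l assms(2), of G] ld by simp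
  fix k assume "k < length (bar_face G i (ratios xs))"
  then have k: "k < n" using length_bar_face[OF l assms(2), of G] by simp
  have c: "xs ! j \<in> carrier G" if "j < Suc (Suc n)" for j using assms that by (auto simp: subset_iff)
  have d: "(take i xs @ drop (Suc i) xs) ! j = (if j < i then xs ! j else xs ! Suc j)" if "j < Suc n" for j
    using assms that by (auto simp: nth_append min_def)
  have "ratios (take i xs @ drop (Suc i) xs) ! k = inv ((take i xs @ drop (Suc i) xs) ! k) \<otimes> (take i xs @ drop (Suc i) xs) ! Suc k"
    by (rule nth_ratios) (use ld k in simp)
  moreover have "inv (xs ! k) \<otimes> xs ! Suc k \<otimes> (inv (xs ! Suc k) \<otimes> xs ! Suc (Suc k)) = inv (xs ! k) \<otimes> xs ! Suc (Suc k)"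
    using c[of k] c[of "Suc k"] c[of "Suc (Suc k)"] k by (simp add: m_assoc cancel)
  ultimately show "bar_face G i (ratios xs) ! k = ratios (take i xs @ drop (Suc i) xs) ! k"
    using k assms by (auto simp: nth_bar_face[OF l assms(2) k] nth_ratios d)
qed

lemma bar_boundary_lin: "bar_boundary G (Suc n) (lin f c) = lin (\<lambda>l. bar_boundary G (Suc n) (f l)) c"
  by (simp add: bar_boundary_def lin_lin)

lemma bar_boundary_tobar:
  assumes "c \<in> chains (carrier G) (Suc (Suc n))"
  shows "bar_boundary G (Suc n) (tobar c) = tobar (BD c)"
  unfolding tobar_def bar_boundary_lin lin_lin
proof (rule lin_cong_chains[OF assms])
  fix xs assume "xs \<in> tuples (carrier G) (Suc (Suc n))"
  then have xs: "length xs = Suc (Suc n)" "set xs \<subseteq> carrier G" by (auto simp: tuples_def)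
  show "bar_boundary G (Suc n) (frag_of (ratios xs)) = lin (\<lambda>l. frag_of (ratios l)) (bd xs)"
    unfolding bar_boundary_of bd_sum xs(1) lessThan_Suc_atMost
    by (simp add: frag_extend_sum lin_simps o_def bar_face_ratios[OF xs(1) _ xs(2)] del: sum.atMost_Suc)
qed

lemma tobar_Nml: "c \<in> chains (carrier G) n \<Longrightarrow> tobar (Nml c) = tobar c"
  unfolding tobar_def Nml_def lin_lin by (erule lin_cong_chains) (simp add: ratios_rebase tuples_def)

lemma Nml_eq_0:
  assumes "c \<in> chains (carrier G) (Suc n)" "tobar c = 0"
  shows "Nml c = 0"
proof -
  have "Nml c = lin (\<lambda>u. frag_of (partials \<one> u)) (tobar c)"
    unfolding tobar_def Nml_def lin_lin
    by (rule lin_cong_chains[OF assms(1)]) (subst rebase_eq_partials, auto simp: tuples_def)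
  then show ?thesis by (simp add: assms)
qed

text \<open>
  A bar cycle lifts to a homogeneous chain whose boundary is zero modulo translation only. Since
  the null-homotopy is translation invariant, this suffices for it to fill the cycle.
\<close>

lemma cycle_is_boundary:
  assumes H: "subgroup H G" and K: "subgroup K G" and h: "null_htpy (Suc n) H K h"
    and z: "z \<in> chains H (Suc n)" "bar_boundary G (Suc n) z = 0"
  shows "z \<in> bar_boundaries G (Suc n)"
proof -
  have HC: "H \<subseteq> carrier G" and KC: "K \<subseteq> carrier G" using H K by (auto dest: subgroup.subset)
  define w where "w = lin (\<lambda>u. frag_of (partials \<one> u)) z"
  have wH: "w \<in> chains H (Suc (Suc n))"
    unfolding w_def by (rule chains_lin[OF z(1)]) (simp add: partials_tuples[OF H] subgroup.one_closed[OF H])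
  have Qw: "tobar w = z"
  proof -
    have "tobar w = lin frag_of z" unfolding w_def tobar_def lin_lin
      by (rule lin_cong_chains[OF z(1)]) (use HC in \<open>auto simp: tuples_def intro!: arg_cong[of _ _ frag_of] ratios_partials\<close>)
    then show ?thesis by simp
  qed
  have wC: "w \<in> chains (carrier G) (Suc (Suc n))" by (rule chains_mono[OF HC wH])
  have "tobar (BD w) = 0" using bar_boundary_tobar[OF wC] Qw z(2) by simp
  then have NB: "Nml (BD w) = Nml 0" using Nml_eq_0[OF BD_chains[OF wC]] by simp
  have hc: "h u \<in> chains K (Suc k)" if "u \<in> tuples H k" for u k using h that by (auto simp: null_htpy_def)
  have 0: "Nml (lin h (BD w)) = Nml (lin h 0)"
    by (rule Nml_lin_dep[OF H _ BD_chains[OF wH] _ NB]) (use h in \<open>auto simp: null_htpy_def tuples_def\<close>)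
  have hw: "lin h w \<in> chains K (Suc (Suc (Suc n)))" by (rule chains_lin[OF wH]) (rule hc)
  have hwC: "lin h w \<in> chains (carrier G) (Suc (Suc (Suc n)))" by (rule chains_mono[OF KC hw])
  have "Nml (BD (lin h w)) = lin (\<lambda>u. frag_of (rebase u) - Nml (lin h (bd u))) w"
    unfolding Nml_lin lin_lin
  proof (rule lin_cong_chains[OF wH])
    fix u assume "u \<in> tuples H (Suc (Suc n))"
    then have "Nml (BD (h u)) + Nml (lin h (bd u)) = frag_of (rebase u)"
      using h by (auto simp: null_htpy_def tuples_def)
    then show "lin (\<lambda>l. Nml (bd l)) (h u) = frag_of (rebase u) - lin (\<lambda>l. Nml (h l)) (bd u)"
      by (simp add: Nml_lin algebra_simps)
  qed
  also have "\<dots> = Nml w - Nml (lin h (BD w))" by (simp add: lin_fun_simps lin_lin Nml_lin) (simp add: Nml_def)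
  also have "\<dots> = Nml w" using 0 by simp
  finally have "tobar (BD (lin h w)) = tobar (Nml w)" using tobar_Nml[OF BD_chains[OF hwC]] by simp
  then have "bar_boundary G (Suc (Suc n)) (tobar (lin h w)) = z"
    using bar_boundary_tobar[OF hwC] tobar_Nml[OF wC] Qw by simp
  moreover have "tobar (lin h w) \<in> chains (carrier G) (Suc (Suc n))"
    unfolding tobar_def by (rule chains_lin[OF hwC]) (use ratios_tuples[OF subgroup_self] in force)
  then have "tobar (lin h w) \<in> carrier (bar_chains G (Suc (Suc n)))"
    by (simp add: bar_chains_def chains_def tuples_def bar_tuples_def)
  ultimately show ?thesis unfolding bar_boundaries_def by blast
qed

lemma trivial_group_homologyI:
  assumes "bar_cycles G n \<subseteq> bar_boundaries G n"
  shows "trivial_group (group_homology G n)"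
proof -
  let ?C = "bar_chains G n" and ?Z = "bar_cycles G n"
  have eq: "bar_boundaries G n = ?Z"
    using assms bar_boundaries_subset_bar_cycles[OF is_group] by blast
  interpret C: comm_group ?C
    by (simp add: bar_chains_def abelian_free_Abelian_group)
  have "subgroup ?Z ?C"
  proof (rule C.subgroupI)
    have l: "bar_boundary G n (a + b) = bar_boundary G n a + bar_boundary G n b"
      "bar_boundary G n (- a) = - bar_boundary G n a" "bar_boundary G n 0 = 0" for a b
      by (simp_all add: bar_boundary_def lin_simps)
    show "?Z \<subseteq> carrier ?C" by (auto simp: bar_cycles_def)
    have "0 \<in> ?Z" by (simp add: bar_cycles_def bar_chains_def l)
    then show "?Z \<noteq> {}" by blast
    show "inv\<^bsub>?C\<^esub> a \<in> ?Z" if "a \<in> ?Z" for a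
      using that by (auto simp: bar_cycles_def bar_chains_def l)
    show "a \<otimes>\<^bsub>?C\<^esub> b \<in> ?Z" if "a \<in> ?Z" "b \<in> ?Z" for a b
      using that keys_add[of a b] by (auto simp: bar_cycles_def bar_chains_def l)
  qed
  then have Z: "carrier (subgroup_generated ?C ?Z) = ?Z"
    by (rule subgroup.carrier_subgroup_generated_subgroup)
  interpret S: comm_group "subgroup_generated ?C ?Z"
    by (rule C.abelian_subgroup_generated[OF C.comm_group_axioms])
  have n: "?Z \<lhd> subgroup_generated ?C ?Z"
    using S.subgroup_imp_normal[OF S.subgroup_self] by (simp add: Z)
  have "?Z #>\<^bsub>subgroup_generated ?C ?Z\<^esub> x = ?Z" if "x \<in> ?Z" for x
    using S.coset_join2[of x ?Z] that S.subgroup_self by (simp add: Z)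
  then have "carrier (subgroup_generated ?C ?Z Mod ?Z) = {?Z}"
    using S.one_closed by (auto simp: carrier_FactGroup Z)
  then show ?thesis
    unfolding group_homology_def eq trivial_group_def
    using normal.factorgroup_is_group[OF n] by (simp add: FactGroup_def)
qed

text \<open>
  A cycle involves only finitely many group elements, so it lives in some stage of the tower;
  after as many further stages as its degree it is a boundary.
\<close>

theorem swindle_tower_acyclic:
  assumes T: "swindle_tower G H b t"
  shows "integrally_acyclic G"
proof -
  have sub: "subgroup (H n) G" and mono1: "H n \<subseteq> H (Suc n)"
    and b_mem: "x \<in> H n \<Longrightarrow> b n x \<in> H (Suc n)" and t_mem: "t n \<in> H (Suc n)"
    and b_mult: "x \<in> H n \<Longrightarrow> y \<in> H n \<Longrightarrow> b n (x \<otimes> y) = b n x \<otimes> b n y"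
    and b_comm: "x \<in> H n \<Longrightarrow> y \<in> H n \<Longrightarrow> x \<otimes> b n y = b n y \<otimes> x"
    and t: "x \<in> H n \<Longrightarrow> t n \<otimes> b n x = x \<otimes> b n x \<otimes> t n" for n x y
    using T unfolding swindle_tower_def by (simp_all add: image_subset_iff)
  have mono: "i \<le> j \<Longrightarrow> H i \<subseteq> H j" for i j
    by (rule lift_Suc_mono_le[of H]) (auto simp: mono1)
  have null: "\<exists>h. null_htpy k (H m) (H (m + k)) h" for k m
  proof (induction k)
    case 0
    have "null_htpy 0 (H m) (H (m + 0)) (\<lambda>_. 0)" by (auto simp: null_htpy_def)
    then show ?case by blast
  next
    case (Suc k)
    then obtain h where h: "null_htpy k (H m) (H (m + k)) h" by blast
    have mk: "H m \<subseteq> H (m + k)" by (rule mono) simp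
    interpret swindle G "H m" "H (m + k)" "H (Suc (m + k))" "b (m + k)" "t (m + k)"
      by (intro swindle.intro swindle_axioms.intro sub mono1 mk is_group t_mem b_mem b_mult b_comm t)
        (use mk in auto)
    show ?case using null_htpy_step[OF h] by simp
  qed
  have fin: "\<exists>m. A \<subseteq> H m" if "finite A" "A \<subseteq> (\<Union>n. H n)" for A
    using that
  proof (induction A)
    case (insert x A)
    then obtain m k where "A \<subseteq> H m" "x \<in> H k" by blast
    then have "insert x A \<subseteq> H (max m k)" using mono[of m "max m k"] mono[of k "max m k"] by auto
    then show ?case by blast
  qed simp
  have "bar_cycles G (Suc n) \<subseteq> bar_boundaries G (Suc n)" for n
  proof
    fix z assume "z \<in> bar_cycles G (Suc n)"
    then have z: "bar_boundary G (Suc n) z = 0" "Poly_Mapping.keys z \<subseteq> tuples (carrier G) (Suc n)"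
      by (auto simp: bar_cycles_def bar_chains_def bar_tuples_def tuples_def)
    have "\<Union>(set ` Poly_Mapping.keys z) \<subseteq> carrier G" using z(2) by (auto simp: tuples_def)
    then have "\<Union>(set ` Poly_Mapping.keys z) \<subseteq> (\<Union>n. H n)" using T by (simp add: swindle_tower_def)
    then obtain m where m: "\<Union>(set ` Poly_Mapping.keys z) \<subseteq> H m"
      using fin[of "\<Union>(set ` Poly_Mapping.keys z)"] by auto
    then have zm: "z \<in> chains (H m) (Suc n)" using z(2) by (auto simp: chains_def tuples_def)
    obtain h where "null_htpy (Suc n) (H m) (H (m + Suc n)) h" using null by blast
    then show "z \<in> bar_boundaries G (Suc n)"
      by (rule cycle_is_boundary[OF sub sub _ zm z(1)])
  qed
  then have "trivial_group (group_homology G (Suc n))" for n by (rule trivial_group_homologyI)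
  then show ?thesis
    unfolding integrally_acyclic_def by (metis gr0_implies_Suc)
qed

end

section \<open>Normal subgroups of symmetric groups\<close>

text \<open>
  The prefix \<open>inv\<close> denotes inverses in groups.
\<close>

abbreviation finv :: "('a \<Rightarrow> 'b) \<Rightarrow> 'b \<Rightarrow> 'a" where "finv \<equiv> inv_into UNIV"

lemma eqpoll_Times_self:
  assumes "infinite (UNIV :: 'v set)"
  shows "(UNIV :: ('v \<times> 'v) set) \<approx> (UNIV :: 'v set)"
  using card_of_Times_same_infinite[OF assms] by (simp add: eqpoll_iff_card_of_ordIso)

lemma ex_bij_times_int:
  assumes "infinite (UNIV :: 'v set)"
  shows "\<exists>q :: 'v \<Rightarrow> 'v \<times> int. bij q"
proof -
  obtain f :: "nat \<Rightarrow> 'v" where f: "inj f" using infinite_countable_subset[OF assms] by blast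
  have "inj (\<lambda>p :: 'v \<times> int. (fst p, f (int_encode (snd p))))"
    using inj_int_encode[of UNIV] f by (auto simp: inj_def prod_eq_iff)
  then have "(UNIV :: ('v \<times> int) set) \<lesssim> (UNIV :: ('v \<times> 'v) set)" by (auto simp: lepoll_def)
  also have "(UNIV :: ('v \<times> 'v) set) \<approx> (UNIV :: 'v set)" by (rule eqpoll_Times_self[OF assms])
  finally have 1: "(UNIV :: ('v \<times> int) set) \<lesssim> (UNIV :: 'v set)" .
  have "inj (\<lambda>x :: 'v. (x, 0 :: int))" by (auto simp: inj_def)
  then have "(UNIV :: 'v set) \<lesssim> (UNIV :: ('v \<times> int) set)" by (auto simp: lepoll_def)
  from lepoll_antisym[OF this 1] show ?thesis by (auto simp: eqpoll_def)
qed

lemma ex_bij_image: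
  assumes "A \<approx> B" "- A \<approx> - B"
  shows "\<exists>w. bij w \<and> w ` A = B"
proof -
  obtain f g where f: "bij_betw f A B" and g: "bij_betw g (- A) (- B)"
    using assms by (auto simp: eqpoll_def)
  define w where "w x = (if x \<in> A then f x else g x)" for x
  have "bij_betw w A B" "bij_betw w (- A) (- B)"
    using f g bij_betw_cong[of A w f B] bij_betw_cong[of "- A" w g "- B"] by (auto simp: w_def)
  then have "bij_betw w (A \<union> - A) (B \<union> - B)" by (rule bij_betw_combine) simp
  then show ?thesis using \<open>bij_betw w A B\<close> by (auto simp: bij_betw_def)
qed

lemma restrict_to_range:
  assumes i: "inj i" and p: "bij p" "\<And>x. x \<notin> range i \<Longrightarrow> p x = x"
  shows "\<exists>f. bij f \<and> (\<forall>v. p (i v) = i (f v))"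
proof -
  have r: "p x \<in> range i \<longleftrightarrow> x \<in> range i" for x
    using p bij_pointE injD[OF bij_is_inj[OF p(1)]] by metis
  then have "\<forall>v. \<exists>u. p (i v) = i u" by blast
  then obtain f where f: "\<And>v. p (i v) = i (f v)" by metis
  have "bij f"
  proof (rule bijI)
    show "inj f" using f i p(1) by (metis bij_is_inj injD injI)
    show "surj f"
      unfolding surj_def
    proof
      fix u
      obtain x where x: "p x = i u" using p(1) by (metis bij_pointE)
      then obtain v where "x = i v" using r[of x] by auto
      then have "i (f v) = i u" using x f by simp
      then show "\<exists>v. u = f v" using i by (metis injD)
    qed
  qed
  then show ?thesis using f by blast
qed

text \<open>
  Normal subgroups of the full symmetric group, possibly empty.
\<close>

definition perm_normal :: "('b \<Rightarrow> 'b) set \<Rightarrow> bool" where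
  "perm_normal M \<longleftrightarrow> (\<forall>F\<in>M. bij F \<and> finv F \<in> M) \<and> (\<forall>F\<in>M. \<forall>F'\<in>M. F \<circ> F' \<in> M) \<and>
    (\<forall>F\<in>M. \<forall>C. bij C \<longrightarrow> C \<circ> F \<circ> finv C \<in> M)"

lemma bij_finv_f [simp]: "bij C \<Longrightarrow> finv C (C x) = x"
  by (simp add: bij_is_inj)

lemma bij_f_finv [simp]: "bij C \<Longrightarrow> C (finv C x) = x"
  by (simp add: bij_is_surj surj_f_inv_f)

text \<open>
  If \<open>g\<close> moves \<open>z\<close>, then \<open>map_prod g id\<close> moves the whole fibre over \<open>z\<close> off itself. Its
  commutator with a permutation of this fibre consists of that permutation on the fibre over \<open>g
  z\<close> and of the inverse on the fibre over \<open>z\<close>; a commutator with a second permutation of the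
  fibre over \<open>z\<close> removes the former. So \<open>M\<close> contains all commutators of permutations of a fibre,
  and by an infinite repetition argument all permutations of a subset of the fibre, of full
  cardinality and with complement of full cardinality. All sets of this kind are conjugate, and
  \<open>map_prod h id\<close> is a product of two permutations with supports inside such sets.

  Without the product with a second factor this fails: permutations of finite support form a
  normal subgroup of a symmetric group.
\<close>

theorem perm_normal_pair:
  fixes M :: "('v \<times> 'v \<Rightarrow> 'v \<times> 'v) set"
  assumes inf: "infinite (UNIV :: 'v set)" and M: "perm_normal M"
    and g: "map_prod g id \<in> M" "bij g" "g z \<noteq> z" and h: "bij h"
  shows "map_prod h id \<in> M"
proof -
  obtain q :: "'v \<Rightarrow> 'v \<times> int" where q: "bij q" using ex_bij_times_int[OF inf] by blast
  have M_bij: "bij F" and M_inv: "finv F \<in> M" and M_comp: "F' \<in> M \<Longrightarrow> F \<circ> F' \<in> M"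
    and M_conj: "bij C \<Longrightarrow> C \<circ> F \<circ> finv C \<in> M" if "F \<in> M" for F F' C
    using M that unfolding perm_normal_def by blast+
  define ctrl where "ctrl F = (\<lambda>(x, y). if x = z then (x, F y) else (x, y))" for F :: "'v \<Rightarrow> 'v"
  have ctrl_inv: "ctrl F \<circ> ctrl (finv F) = id" "ctrl (finv F) \<circ> ctrl F = id" if "bij F" for F
    using that by (auto simp: ctrl_def fun_eq_iff)
  have ctrl: "bij (ctrl F)" "finv (ctrl F) = ctrl (finv F)" if "bij F" for F
    using ctrl_inv[OF that] by (auto intro: o_bij inv_unique_comp)
  let ?G = "map_prod g (id :: 'v \<Rightarrow> 'v)"
  have G: "bij ?G" by (rule M_bij[OF g(1)])
  have G': "finv ?G = map_prod (finv g) id"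
    by (rule inv_unique_comp) (use g in \<open>simp_all add: fun_eq_iff\<close>)
  have comm: "ctrl (finv F \<circ> C \<circ> F \<circ> finv C) \<in> M" if F: "bij F" and C: "bij C" for F C
  proof -
    define c where "c = ?G \<circ> (ctrl F \<circ> finv ?G \<circ> finv (ctrl F))"
    have c: "c \<in> M" unfolding c_def using F g(1) by (intro M_comp M_conj M_inv ctrl)
    have c': "finv c = (ctrl F \<circ> ?G \<circ> finv (ctrl F)) \<circ> finv ?G"
      by (rule inv_unique_comp) (use F G ctrl[OF F] in \<open>auto simp: c_def fun_eq_iff\<close>)
    have "c \<circ> (ctrl C \<circ> finv c \<circ> finv (ctrl C)) \<in> M"
      using C c by (intro M_comp M_conj M_inv ctrl)
    moreover have "c \<circ> (ctrl C \<circ> finv c \<circ> finv (ctrl C)) = ctrl (finv F \<circ> C \<circ> F \<circ> finv C)"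
    proof
      fix p :: "'v \<times> 'v"
      obtain x y where p: "p = (x, y)" by (cases p)
      have gz: "finv g z \<noteq> z" "\<And>x. finv g x = z \<longleftrightarrow> x = g z" "\<And>x. g x = z \<longleftrightarrow> x = finv g z"
        using g(2,3) by (metis bij_finv_f bij_f_finv)+
      show "(c \<circ> (ctrl C \<circ> finv c \<circ> finv (ctrl C))) p = ctrl (finv F \<circ> C \<circ> F \<circ> finv C) p"
        unfolding p c' unfolding c_def ctrl(2)[OF F] ctrl(2)[OF C] G'
        using F C g(2,3) gz by (auto simp: ctrl_def)
    qed
    ultimately show ?thesis by simp
  qed
  define ii where "ii v = (z, finv q (v, 0))" for v
  have q_finv: "q (finv q (v, k)) = (v, k)" for v k by (rule bij_f_finv[OF q])
  have ii: "inj ii"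
  proof (rule injI)
    fix v w assume "ii v = ii w"
    then have "finv q (v, 0) = finv q (w, 0)" by (simp add: ii_def)
    then show "v = w" using q_finv by (metis prod.inject)
  qed
  have S0: "range ii = {z} \<times> {y. snd (q y) = 0}"
  proof (rule subset_antisym; rule subsetI)
    fix x assume "x \<in> range ii"
    then show "x \<in> {z} \<times> {y. snd (q y) = 0}" by (auto simp: ii_def q_finv)
  next
    fix x assume "x \<in> {z} \<times> {y. snd (q y) = 0}"
    then obtain y v where "x = (z, y)" "q y = (v, 0)" by (cases "q (snd x)") auto
    moreover have "finv q (q y) = y" using q by simp
    ultimately have "x = ii v" by (simp add: ii_def)
    then show "x \<in> range ii" by blast
  qed
  have supp: "p \<in> M" if p: "bij p" "\<And>x. x \<notin> range ii \<Longrightarrow> p x = x" for p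
  proof -
    obtain f where f: "bij f" "\<And>v. p (ii v) = ii (f v)" using restrict_to_range[OF ii p] by blast
    \<comment> \<open>Acting as f on all nonnegative copies and undoing this on the shifted copies
      leaves f on copy 0 only.\<close>
    define a where "a e = (\<lambda>(v, k :: int). if 0 \<le> k then (e v, k) else (v, k))" for e :: "'v \<Rightarrow> 'v"
    define s where "s = (\<lambda>(v :: 'v, k :: int). (v, k + 1))"
    define s' where "s' = (\<lambda>(v :: 'v, k :: int). (v, k - 1))"
    have aa: "a f \<circ> a (finv f) = id" "a (finv f) \<circ> a f = id" using f by (auto simp: a_def fun_eq_iff)
    have ss: "s \<circ> s' = id" "s' \<circ> s = id" by (auto simp: s_def s'_def fun_eq_iff)
    let ?F = "finv q \<circ> a (finv f) \<circ> q" and ?C = "finv q \<circ> s \<circ> q"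
    let ?F' = "finv q \<circ> a f \<circ> q" and ?C' = "finv q \<circ> s' \<circ> q"
    have aa': "a f (a (finv f) x) = x" "a (finv f) (a f x) = x" "s (s' x) = x" "s' (s x) = x" for x
      using aa ss by (metis comp_apply id_apply)+
    have FF: "?F' \<circ> ?F = id" "?F \<circ> ?F' = id" and CC: "?C' \<circ> ?C = id" "?C \<circ> ?C' = id"
      using q by (simp_all add: fun_eq_iff aa')
    have F: "bij ?F" "finv ?F = ?F'" by (rule o_bij[OF FF]) (rule inv_unique_comp[OF FF(2,1)])
    have C: "bij ?C" "finv ?C = ?C'" by (rule o_bij[OF CC]) (rule inv_unique_comp[OF CC(2,1)])
    have "ctrl (finv ?F \<circ> ?C \<circ> ?F \<circ> finv ?C) = p"
    proof
      fix x :: "'v \<times> 'v"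
      show "ctrl (finv ?F \<circ> ?C \<circ> ?F \<circ> finv ?C) x = p x"
      proof (cases "x \<in> range ii")
        case True
        then obtain v where v: "x = ii v" by blast
        show ?thesis
          using q f unfolding v f(2) F(2) C(2) by (simp add: ii_def ctrl_def a_def s_def s'_def)
      next
        case False
        obtain u y where x: "x = (u, y)" by (cases x)
        obtain v k where vk: "q y = (v, k)" by (cases "q y")
        have y: "y = finv q (v, k)" using q vk by (metis bij_finv_f)
        have "u \<noteq> z \<or> k \<noteq> 0" using False S0 x vk by auto
        then show ?thesis
          using q f p(2)[OF False] unfolding F(2) C(2) by (auto simp: x ctrl_def a_def s_def s'_def y)
      qed
    qed
    then show ?thesis using comm[OF F(1) C(1)] by simp
  qed
  let ?V0 = "{y. snd (q y) = 0}"
  have big: "X \<approx> (UNIV :: 'v set)" if "{x} \<times> Y \<subseteq> X" "(UNIV :: 'v set) \<lesssim> Y" for X :: "('v \<times> 'v) set" and x Y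
  proof (rule lepoll_antisym)
    have "X \<lesssim> (UNIV :: ('v \<times> 'v) set)" by (rule subset_imp_lepoll) simp
    then show "X \<lesssim> (UNIV :: 'v set)" using eqpoll_Times_self[OF inf] lepoll_trans2 by blast
    have "Y \<lesssim> {x} \<times> Y" unfolding lepoll_def by (rule exI[of _ "Pair x"]) (auto simp: inj_on_def)
    then show "(UNIV :: 'v set) \<lesssim> X" using that by (meson lepoll_trans subset_imp_lepoll)
  qed
  have V0: "(UNIV :: 'v set) \<lesssim> ?V0" "(UNIV :: 'v set) \<lesssim> - ?V0"
  proof -
    have "inj (\<lambda>v. finv q (v, k))" for k by (rule injI) (metis q_finv prod.inject)
    moreover have "range (\<lambda>v. finv q (v, 0)) \<subseteq> ?V0" "range (\<lambda>v. finv q (v, 1)) \<subseteq> - ?V0"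
      by (auto simp: q_finv)
    ultimately show "(UNIV :: 'v set) \<lesssim> ?V0" "(UNIV :: 'v set) \<lesssim> - ?V0" unfolding lepoll_def by blast+
  qed
  have half: "p \<in> M" if Y: "(UNIV :: 'v set) \<lesssim> Y" "(UNIV :: 'v set) \<lesssim> - Y"
    and p: "bij p" "\<And>x. snd x \<notin> Y \<Longrightarrow> p x = x" for p and Y :: "'v set"
  proof -
    let ?A = "(UNIV :: 'v set) \<times> Y"
    have "?A \<approx> (UNIV :: 'v set)" "- ?A \<approx> (UNIV :: 'v set)" "range ii \<approx> (UNIV :: 'v set)" "- range ii \<approx> (UNIV :: 'v set)"
      by (rule big[of z Y], use Y in auto)
        (rule big[of z "- Y"] big[of z ?V0] big[of z "- ?V0"]; use Y V0 in \<open>auto simp: S0\<close>)+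
    then have "?A \<approx> range ii" "- ?A \<approx> - range ii"
      using eqpoll_trans eqpoll_sym by blast+
    then obtain w where w: "bij w" "w ` ?A = range ii" using ex_bij_image by blast
    have "w \<circ> p \<circ> finv w \<in> M"
    proof (rule supp)
      show "bij (w \<circ> p \<circ> finv w)" using w p by (simp add: bij_comp bij_imp_bij_inv)
      fix x assume "x \<notin> range ii"
      then have "finv w x \<notin> ?A" using w by (metis image_eqI bij_f_finv)
      then have "p (finv w x) = finv w x" using p(2) by (metis SigmaI UNIV_I prod.collapse)
      then show "(w \<circ> p \<circ> finv w) x = x" using w by simp
    qed
    then have "finv w \<circ> (w \<circ> p \<circ> finv w) \<circ> finv (finv w) \<in> M"
      by (rule M_conj) (simp add: w bij_imp_bij_inv)
    also have "finv w \<circ> (w \<circ> p \<circ> finv w) \<circ> finv (finv w) = p"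
      using w by (simp add: fun_eq_iff inv_inv_eq)
    finally show ?thesis .
  qed
  define p where "p Y = (\<lambda>(x, y). if y \<in> Y then (h x, y) else (x, y))" for Y :: "'v set"
  have "bij (p Y)" for Y
    by (rule o_bij[of "\<lambda>(x, y). if y \<in> Y then (finv h x, y) else (x, y)"]) (use h in \<open>auto simp: p_def fun_eq_iff\<close>)
  then have pM: "p Y \<in> M" if "(UNIV :: 'v set) \<lesssim> Y" "(UNIV :: 'v set) \<lesssim> - Y" for Y
    by (rule half[OF that]) (auto simp: p_def)
  have "p ?V0 \<in> M" "p (- ?V0) \<in> M"
    by (rule pM, use V0 in simp_all)+
  moreover have "p ?V0 \<circ> p (- ?V0) = map_prod h id" by (auto simp: p_def fun_eq_iff)
  ultimately show ?thesis using M_comp by metis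
qed

section \<open>The limit of the symmetric groups of powers\<close>

text \<open>
  The set \<open>V\<close>: it is infinite, its square and its power with exponent \<open>\<int>\<close> are in bijection with
  it, and it has room for the coding permutations below.
\<close>

type_synonym seq = "nat \<Rightarrow> int"

definition phi :: "seq \<times> seq \<Rightarrow> seq" where
  "phi = (SOME f. bij f)"

lemma infinite_seq: "infinite (UNIV :: seq set)"
proof -
  have "inj (\<lambda>k :: int. (\<lambda>n :: nat. k))" by (auto simp: inj_def fun_eq_iff)
  then show ?thesis using infinite_UNIV_int finite_imageD[of "\<lambda>k :: int. (\<lambda>n :: nat. k)" UNIV]
    by (meson finite_subset subset_UNIV)
qed

lemma bij_phi: "bij phi"
proof -
  have "\<exists>f :: seq \<times> seq \<Rightarrow> seq. bij f"
    using eqpoll_Times_self[OF infinite_seq] by (auto simp: eqpoll_def)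
  then show ?thesis unfolding phi_def by (rule someI_ex)
qed

text \<open>
  The bijection from \<open>V \<times> V\<close> to \<open>V\<^sup>\<int>\<close> keeps the first component as coordinate \<open>0\<close>; for \<open>k \<noteq> 0\<close>
  the number \<open>int_encode k - 1\<close> runs through the natural numbers, and these coordinates are read
  off the second component.
\<close>

definition psi :: "seq \<times> seq \<Rightarrow> int \<Rightarrow> seq" where
  "psi p k = (if k = 0 then fst p else (\<lambda>j. snd p (prod_encode (int_encode k - 1, j))))"

lemma int_encode_eq_0 [simp]: "int_encode k = 0 \<longleftrightarrow> k = 0"
proof -
  have "int_encode 0 = 0" by (simp add: int_encode_def sum_encode_def)
  then show ?thesis by (metis int_encode_eq)
qed

lemma bij_psi: "bij psi"
proof -
  define r where "r w = (w 0, \<lambda>m. w (int_decode (Suc (fst (prod_decode m)))) (snd (prod_decode m)))"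
    for w :: "int \<Rightarrow> seq"
  have d: "int_decode (Suc i) \<noteq> 0" for i
    by (metis int_decode_inverse int_encode_eq_0 nat.distinct(1))
  have "Suc (int_encode k - 1) = int_encode k" if "k \<noteq> 0" for k
    using that int_encode_eq_0[of k] by linarith
  then have "psi (r w) = w" for w
    by (auto simp: psi_def r_def fun_eq_iff simp del: One_nat_def)
  moreover have "r (psi p) = p" for p
    by (simp add: psi_def r_def d)
  ultimately show ?thesis by (intro o_bij[of r]) (auto simp: fun_eq_iff)
qed

text \<open>
  All permutation groups in the chain are realised on the infinite product \<open>V\<^sup>\<nat>\<close>. The map
  \<open>merge\<close> encodes the first two coordinates into one, so that conjugation by its powers turns
  permutations of the first coordinate into permutations of the first \<open>n + 1\<close> coordinates, and
  \<open>stage n\<close> of a permutation of \<open>V \<times> V\<close> acts on the first \<open>n + 2\<close> coordinates.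
\<close>

definition at01 :: "(seq \<times> seq \<Rightarrow> seq \<times> seq) \<Rightarrow> (nat \<Rightarrow> seq) \<Rightarrow> (nat \<Rightarrow> seq)" where
  "at01 F \<omega> = \<omega>(0 := fst (F (\<omega> 0, \<omega> 1)), 1 := snd (F (\<omega> 0, \<omega> 1)))"

definition merge :: "(nat \<Rightarrow> seq) \<Rightarrow> (nat \<Rightarrow> seq)" where
  "merge \<omega> = (\<lambda>i. if i = 0 then phi (\<omega> 0, \<omega> 1) else \<omega> (Suc i))"

lemma at01_comp: "at01 F \<circ> at01 F' = at01 (F \<circ> F')"
  by (auto simp: at01_def fun_eq_iff)

lemma at01_id: "at01 id = id"
  by (auto simp: at01_def fun_eq_iff)

lemma at01_inj: "at01 F = at01 F' \<longleftrightarrow> F = F'"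
proof
  assume e: "at01 F = at01 F'"
  show "F = F'"
  proof
    fix p :: "seq \<times> seq"
    obtain a c where p: "p = (a, c)" by (cases p)
    show "F p = F' p"
      using fun_cong[OF fun_cong[OF e, of "\<lambda>i. if i = 0 then a else c"], of 0]
        fun_cong[OF fun_cong[OF e, of "\<lambda>i. if i = 0 then a else c"], of 1]
      by (simp add: at01_def p prod_eq_iff)
  qed
qed simp

lemma bij_merge: "bij merge"
proof -
  define m' where "m' \<omega> = (\<lambda>i. if i = 0 then fst (finv phi (\<omega> 0)) else if i = 1 then snd (finv phi (\<omega> 0)) else \<omega> (i - 1))"
    for \<omega> :: "nat \<Rightarrow> seq"
  have "m' (merge \<omega>) = \<omega>" for \<omega>
  proof
    fix i show "m' (merge \<omega>) i = \<omega> i"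
      using bij_phi by (cases i; cases "i - 1") (auto simp: m'_def merge_def)
  qed
  moreover have "merge (m' \<omega>) = \<omega>" for \<omega>
    using bij_phi by (auto simp: m'_def merge_def fun_eq_iff)
  ultimately show ?thesis by (intro o_bij[of m']) (auto simp: fun_eq_iff)
qed

lemma merge_at01: "merge \<circ> at01 (finv phi \<circ> f \<circ> phi) = at01 (map_prod f id) \<circ> merge"
  using bij_phi by (auto simp: merge_def at01_def fun_eq_iff)

definition stage :: "nat \<Rightarrow> (seq \<times> seq \<Rightarrow> seq \<times> seq) \<Rightarrow> (nat \<Rightarrow> seq) \<Rightarrow> (nat \<Rightarrow> seq)" where
  "stage n F = finv (merge ^^ n) \<circ> at01 F \<circ> (merge ^^ n)"

lemma bij_merge_pow: "bij (merge ^^ n)"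
  by (rule bij_fn[OF bij_merge])

lemma stage_comp: "stage n F \<circ> stage n F' = stage n (F \<circ> F')"
  using bij_merge_pow[of n] by (simp add: stage_def fun_eq_iff flip: at01_comp)

lemma stage_id: "stage n id = id"
  using bij_merge_pow[of n] by (simp add: stage_def at01_id fun_eq_iff)

lemma stage_inj: "stage n F = stage n F' \<longleftrightarrow> F = F'"
proof
  assume "stage n F = stage n F'"
  then have "(merge ^^ n) \<circ> stage n F \<circ> finv (merge ^^ n) = (merge ^^ n) \<circ> stage n F' \<circ> finv (merge ^^ n)" by simp
  then have "at01 F = at01 F'"
    using bij_merge_pow[of n] by (simp add: stage_def fun_eq_iff)
  then show "F = F'" by (simp add: at01_inj)
qed simp

lemma stage_bij: "bij F \<Longrightarrow> bij (stage n F) \<and> finv (stage n F) = stage n (finv F)"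
proof -
  assume F: "bij F"
  have "F \<circ> finv F = id" "finv F \<circ> F = id" using F by (auto simp: fun_eq_iff)
  then have "stage n F \<circ> stage n (finv F) = id" "stage n (finv F) \<circ> stage n F = id" by (simp_all only: stage_comp stage_id)
  then show ?thesis using o_bij inv_unique_comp by metis
qed

text \<open>
  Hence the permutations of one coordinate at stage \<open>n + 1\<close> are all permutations of two
  coordinates at stage \<open>n\<close>.
\<close>

lemma stage_Suc: "stage (Suc n) (map_prod f id) = stage n (finv phi \<circ> f \<circ> phi)"
proof -
  have "finv (merge ^^ Suc n) = finv (merge ^^ n) \<circ> finv merge"
    using o_inv_distrib[OF bij_merge bij_merge_pow[of n]] by (simp only: funpow.simps)
  then have "stage (Suc n) (map_prod f id) = finv (merge ^^ n) \<circ> (finv merge \<circ> (at01 (map_prod f id) \<circ> merge)) \<circ> (merge ^^ n)"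
    unfolding stage_def by (simp only: comp_assoc funpow.simps)
  also have "finv merge \<circ> (at01 (map_prod f id) \<circ> merge) = at01 (finv phi \<circ> f \<circ> phi)"
    unfolding merge_at01[symmetric] using bij_merge by (simp add: fun_eq_iff)
  finally show ?thesis unfolding stage_def by (simp only: comp_assoc)
qed

definition tower :: "nat \<Rightarrow> ((nat \<Rightarrow> seq) \<Rightarrow> (nat \<Rightarrow> seq)) set" where
  "tower n = {stage n (map_prod f id) | f. bij f}"

lemma bij_phi_conj: "bij (finv phi \<circ> f \<circ> phi) \<longleftrightarrow> bij f" for f :: "seq \<Rightarrow> seq"
proof
  assume b: "bij (finv phi \<circ> f \<circ> phi)"
  have "bij (phi \<circ> (finv phi \<circ> f \<circ> phi) \<circ> finv phi)"
    by (rule bij_comp[OF bij_imp_bij_inv[OF bij_phi] bij_comp[OF b bij_phi]])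
  also have "phi \<circ> (finv phi \<circ> f \<circ> phi) \<circ> finv phi = f" using bij_phi by (simp add: fun_eq_iff)
  finally show "bij f" .
qed (use bij_phi in \<open>intro bij_comp bij_imp_bij_inv\<close>)

lemma tower_Suc: "tower (Suc n) = {stage n F | F. bij F}"
proof -
  have "\<exists>f. bij f \<and> F = finv phi \<circ> f \<circ> phi" if "bij F" for F
    by (rule exI[of _ "phi \<circ> F \<circ> finv phi"])
      (use that bij_phi in \<open>auto simp: fun_eq_iff intro!: bij_comp bij_imp_bij_inv\<close>)
  then show ?thesis unfolding tower_def stage_Suc by (auto simp: bij_phi_conj)
qed

lemma bij_map_prod_id: "bij f \<Longrightarrow> bij (map_prod f id) \<and> finv (map_prod f id) = map_prod (finv f) id"
proof -
  assume f: "bij f"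
  have "map_prod f id \<circ> map_prod (finv f) id = id" "map_prod (finv f) id \<circ> map_prod f id = id"
    using f by (auto simp: fun_eq_iff)
  then show ?thesis using o_bij inv_unique_comp by metis
qed

lemma tower_mono1: "tower n \<subseteq> tower (Suc n)"
  unfolding tower_Suc unfolding tower_def using bij_map_prod_id by blast

lemma tower_mono: "m \<le> n \<Longrightarrow> tower m \<subseteq> tower n"
  by (rule lift_Suc_mono_le[of tower]) (auto intro: tower_mono1[THEN subsetD])

definition limgrp :: "((nat \<Rightarrow> seq) \<Rightarrow> (nat \<Rightarrow> seq)) monoid" where
  "limgrp = \<lparr>carrier = (\<Union>n. tower n), monoid.mult = (\<circ>), one = id\<rparr>"

lemma limgrp_simps [simp]: "carrier limgrp = (\<Union>n. tower n)" "x \<otimes>\<^bsub>limgrp\<^esub> y = x \<circ> y" "\<one>\<^bsub>limgrp\<^esub> = id"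
  by (simp_all add: limgrp_def)

lemma tower_comp: "x \<in> tower n \<Longrightarrow> y \<in> tower n \<Longrightarrow> x \<circ> y \<in> tower n"
  unfolding tower_def using bij_comp by (fastforce simp: stage_comp map_prod_compose[symmetric] simp del: map_prod_compose)

lemma tower_finv: "x \<in> tower n \<Longrightarrow> bij x \<and> finv x \<in> tower n"
proof -
  assume "x \<in> tower n"
  then obtain f where f: "x = stage n (map_prod f id)" "bij f" by (auto simp: tower_def)
  have "bij x" "finv x = stage n (map_prod (finv f) id)"
    by (simp_all add: f stage_bij bij_map_prod_id)
  then show ?thesis using bij_imp_bij_inv[OF f(2)] by (auto simp: tower_def)
qed

lemma id_tower: "id \<in> tower n"
  unfolding tower_def using stage_id[of n] by (metis (mono_tags, lifting) bij_id mem_Collect_eq map_prod.id)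

lemma common_tower:
  assumes "x \<in> carrier limgrp" "y \<in> carrier limgrp"
  shows "\<exists>n. x \<in> tower n \<and> y \<in> tower n"
proof -
  obtain m k where "x \<in> tower m" "y \<in> tower k" using assms by auto
  then have "x \<in> tower (max m k)" "y \<in> tower (max m k)"
    using tower_mono[of m "max m k"] tower_mono[of k "max m k"] by auto
  then show ?thesis by blast
qed

lemma group_limgrp: "group limgrp"
proof (rule groupI)
  fix x y assume xy: "x \<in> carrier limgrp" "y \<in> carrier limgrp"
  then show "x \<otimes>\<^bsub>limgrp\<^esub> y \<in> carrier limgrp" using common_tower[OF xy] tower_comp by auto
next
  fix x assume "x \<in> carrier limgrp"
  then obtain n where n: "x \<in> tower n" by auto
  then have "finv x \<circ> x = id" using tower_finv by (auto simp: fun_eq_iff)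
  then show "\<exists>y\<in>carrier limgrp. y \<otimes>\<^bsub>limgrp\<^esub> x = \<one>\<^bsub>limgrp\<^esub>" using tower_finv[OF n] by auto
qed (use id_tower in \<open>auto simp: comp_assoc\<close>)

lemma limgrp_inv: "x \<in> carrier limgrp \<Longrightarrow> inv\<^bsub>limgrp\<^esub> x = finv x"
proof (rule group.inv_equality[OF group_limgrp])
  assume x: "x \<in> carrier limgrp"
  then obtain n where n: "x \<in> tower n" by auto
  show "finv x \<otimes>\<^bsub>limgrp\<^esub> x = \<one>\<^bsub>limgrp\<^esub>" "finv x \<in> carrier limgrp"
    using tower_finv[OF n] by (auto simp: fun_eq_iff)
qed

lemma subgroup_tower: "subgroup (tower n) limgrp"
proof (rule group.subgroupI[OF group_limgrp])
  show "tower n \<noteq> {}" using id_tower[of n] by blast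
  show "inv\<^bsub>limgrp\<^esub> x \<in> tower n" if "x \<in> tower n" for x
  proof -
    have "x \<in> carrier limgrp" using that by auto
    then show ?thesis using limgrp_inv tower_finv[OF that] by metis
  qed
qed (use tower_comp in auto)

lemma stage_in_limgrp: "bij F \<Longrightarrow> stage n F \<in> carrier limgrp"
  using tower_Suc[of n] by auto

text \<open>
  Two elements lie in a common stage, and there \<open>perm_normal_pair\<close> applies to the normal
  subgroup of \<open>Sym (V \<times> V)\<close> that \<open>N\<close> induces at the next stage.
\<close>

theorem simple_limgrp: "is_simple_group limgrp"
  unfolding is_simple_group_def
proof (intro conjI allI impI)
  let ?s = "\<lambda>v :: seq. (\<lambda>i. v i + 1)"
  have s: "bij ?s" by (rule o_bij[of "\<lambda>v i. v i - 1"]) (auto simp: fun_eq_iff)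
  have "map_prod ?s id \<noteq> (id :: seq \<times> seq \<Rightarrow> _)"
    by (auto simp: fun_eq_iff)
  then have "stage 0 (map_prod ?s id) \<noteq> id" using stage_inj[of 0 _ id] by (simp add: stage_id)
  moreover have "stage 0 (map_prod ?s id) \<in> carrier limgrp" using s bij_map_prod_id stage_in_limgrp by blast
  ultimately show "carrier limgrp \<noteq> {\<one>\<^bsub>limgrp\<^esub>}" by auto
next
  fix N assume N: "N \<lhd> limgrp"
  then interpret N: normal N limgrp .
  show "N = carrier limgrp \<or> N = {\<one>\<^bsub>limgrp\<^esub>}"
  proof (cases "N \<subseteq> {id}")
    case True
    then show ?thesis using subgroup.one_closed[OF N.subgroup_axioms] by auto
  next
    case False
    then obtain x where x: "x \<in> N" "x \<noteq> id" by auto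
    have "y \<in> N" if y: "y \<in> carrier limgrp" for y
    proof -
      obtain n where n: "x \<in> tower n" "y \<in> tower n"
        using common_tower[OF N.mem_carrier[OF x(1)] y] by blast
      obtain g h where g: "x = stage n (map_prod g id)" "bij g" and h: "y = stage n (map_prod h id)" "bij h"
        using n unfolding tower_def by auto
      define M where "M = {F. bij F \<and> stage n F \<in> N}"
      have "perm_normal M"
        unfolding perm_normal_def
      proof (intro conjI ballI allI impI)
        fix F assume F: "F \<in> M"
        then have bF: "bij F" and nF: "stage n F \<in> N" by (auto simp: M_def)
        show "bij F" by fact
        have "finv (stage n F) \<in> N"
          using N.m_inv_closed[OF nF] limgrp_inv[OF N.mem_carrier[OF nF]] by simp
        then show "finv F \<in> M" using bF stage_bij[OF bF] by (simp add: M_def bij_imp_bij_inv)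
        show "F \<circ> F' \<in> M" if "F' \<in> M" for F'
          using that bF subgroup.m_closed[OF N.subgroup_axioms nF, of "stage n F'"] by (auto simp: M_def stage_comp bij_comp)
        show "C \<circ> F \<circ> finv C \<in> M" if C: "bij C" for C
        proof -
          have "stage n C \<otimes>\<^bsub>limgrp\<^esub> stage n F \<otimes>\<^bsub>limgrp\<^esub> inv\<^bsub>limgrp\<^esub> (stage n C) \<in> N"
            using N.inv_op_closed2[OF stage_in_limgrp[OF C] nF] .
          then show ?thesis
            using stage_bij[OF C] C bF limgrp_inv[OF stage_in_limgrp[OF C, of n]]
            by (simp add: M_def stage_comp bij_comp bij_imp_bij_inv)
        qed
      qed
      moreover have "map_prod g id \<in> M" using g x(1) by (simp add: M_def bij_map_prod_id)
      moreover obtain z where "g z \<noteq> z"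
      proof -
        have "g \<noteq> id"
        proof
          assume "g = id"
          then have "x = stage n id" using g(1) by (simp only: map_prod.id)
          then show False using x(2) stage_id[of n] by simp
        qed
        then show thesis using that by (auto simp: fun_eq_iff)
      qed
      ultimately have "map_prod h id \<in> M"
        using perm_normal_pair[OF infinite_seq] g(2) h(2) by blast
      then show ?thesis by (simp add: M_def h)
    qed
    then show ?thesis using N.subset by auto
  qed
qed (rule group_limgrp)

text \<open>
  The swindle lives on \<open>V\<^sup>\<int>\<close>, which is \<open>V \<times> V\<close> in disguise.
\<close>

definition on_seqs :: "((int \<Rightarrow> seq) \<Rightarrow> (int \<Rightarrow> seq)) \<Rightarrow> (seq \<times> seq \<Rightarrow> seq \<times> seq)" where
  "on_seqs W = finv psi \<circ> W \<circ> psi"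

lemma on_seqs_comp: "on_seqs W \<circ> on_seqs W' = on_seqs (W \<circ> W')"
  using bij_psi by (simp add: on_seqs_def fun_eq_iff)

lemma on_seqs_bij: "bij W \<Longrightarrow> bij (on_seqs W)"
  unfolding on_seqs_def using bij_psi by (intro bij_comp bij_imp_bij_inv)

lemma map_prod_on_seqs: "map_prod f id = on_seqs (\<lambda>w k. if k = 0 then f (w k) else w k)"
proof -
  have "psi (map_prod f id p) = (\<lambda>k. if k = 0 then f (psi p k) else psi p k)" for p
    by (auto simp: psi_def fun_eq_iff)
  then have "on_seqs (\<lambda>w k. if k = 0 then f (w k) else w k) p = finv psi (psi (map_prod f id p))" for p
    by (simp add: on_seqs_def)
  then show ?thesis using bij_psi by (simp add: fun_eq_iff)
qed

definition pos_copies :: "(seq \<Rightarrow> seq) \<Rightarrow> (int \<Rightarrow> seq) \<Rightarrow> (int \<Rightarrow> seq)" where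
  "pos_copies f w k = (if 0 < k then f (w k) else w k)"

definition shift :: "(int \<Rightarrow> seq) \<Rightarrow> (int \<Rightarrow> seq)" where
  "shift w k = w (k + 1)"

text \<open>
  The definite description recovers the permutation from its action; \<open>swindle_b n\<close> is only
  meaningful on \<open>tower n\<close>.
\<close>

definition swindle_b where
  "swindle_b n x = stage n (on_seqs (pos_copies (THE f. x = stage n (map_prod f id))))"

definition swindle_t where "swindle_t n = stage n (on_seqs shift)"

lemma swindle_b_stage: "swindle_b n (stage n (map_prod f id)) = stage n (on_seqs (pos_copies f))"
proof -
  have "(THE g. stage n (map_prod f id) = stage n (map_prod g id)) = f"
  proof (rule the_equality)
    fix g assume "stage n (map_prod f id) = stage n (map_prod g id)"
    then have e: "map_prod f id = (map_prod g id :: seq \<times> seq \<Rightarrow> _)" by (simp add: stage_inj)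
    show "g = f"
    proof
      fix v show "g v = f v" using fun_cong[OF e, of "(v, v)"] by simp
    qed
  qed simp
  then show ?thesis by (simp add: swindle_b_def)
qed

lemma pos_copies_bij: "bij f \<Longrightarrow> bij (pos_copies f)"
  by (rule o_bij[of "pos_copies (finv f)"]) (auto simp: pos_copies_def fun_eq_iff)

lemma shift_bij: "bij shift"
  by (rule o_bij[of "\<lambda>w k. w (k - 1)"]) (auto simp: shift_def fun_eq_iff)

theorem swindle_tower_limgrp: "swindle_tower limgrp tower swindle_b swindle_t"
  unfolding swindle_tower_def
proof (intro conjI allI ballI)
  fix n
  show "subgroup (tower n) limgrp" by (rule subgroup_tower)
  show "tower n \<subseteq> tower (Suc n)" by (rule tower_mono1)
  show "swindle_b n ` tower n \<subseteq> tower (Suc n)"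
    unfolding tower_Suc unfolding tower_def using on_seqs_bij pos_copies_bij by (auto simp: swindle_b_stage)
  show "swindle_t n \<in> tower (Suc n)"
    unfolding tower_Suc swindle_t_def using on_seqs_bij shift_bij by blast
  fix x assume "x \<in> tower n"
  then obtain f where x: "x = stage n (map_prod f id)" "bij f" by (auto simp: tower_def)
  show "swindle_t n \<otimes>\<^bsub>limgrp\<^esub> swindle_b n x = x \<otimes>\<^bsub>limgrp\<^esub> swindle_b n x \<otimes>\<^bsub>limgrp\<^esub> swindle_t n"
    unfolding x(1) swindle_b_stage swindle_t_def limgrp_simps
    unfolding stage_comp map_prod_on_seqs on_seqs_comp
    by (intro arg_cong[of _ _ "stage n"] arg_cong[of _ _ on_seqs])
      (auto simp: pos_copies_def shift_def fun_eq_iff)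
  fix y assume "y \<in> tower n"
  then obtain g where y: "y = stage n (map_prod g id)" "bij g" by (auto simp: tower_def)
  show "swindle_b n (x \<otimes>\<^bsub>limgrp\<^esub> y) = swindle_b n x \<otimes>\<^bsub>limgrp\<^esub> swindle_b n y"
  proof -
    have "map_prod f id \<circ> map_prod g id = (map_prod (f \<circ> g) id :: seq \<times> seq \<Rightarrow> _)" by (simp add: fun_eq_iff)
    moreover have "pos_copies (f \<circ> g) = pos_copies f \<circ> pos_copies g" by (auto simp: pos_copies_def fun_eq_iff)
    ultimately show ?thesis by (simp only: x y limgrp_simps stage_comp swindle_b_stage on_seqs_comp)
  qed
  show "x \<otimes>\<^bsub>limgrp\<^esub> swindle_b n y = swindle_b n y \<otimes>\<^bsub>limgrp\<^esub> x"
    unfolding x(1) y(1) swindle_b_stage limgrp_simps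
    unfolding stage_comp map_prod_on_seqs on_seqs_comp
    by (intro arg_cong[of _ _ "stage n"] arg_cong[of _ _ on_seqs])
      (auto simp: pos_copies_def fun_eq_iff)
qed (simp add: limgrp_def)

section \<open>Coding sets of natural numbers\<close>

text \<open>
  An isomorphism invariant of pairs of elements. The exponents start at \<open>1\<close>, since \<open>g\<close> commutes
  with itself.
\<close>

definition code_set :: "('a, 'b) monoid_scheme \<Rightarrow> 'a \<Rightarrow> 'a \<Rightarrow> nat set" where
  "code_set G g h = {n. let k = h [^]\<^bsub>G\<^esub> Suc n; g' = k \<otimes>\<^bsub>G\<^esub> g \<otimes>\<^bsub>G\<^esub> inv\<^bsub>G\<^esub> k in g \<otimes>\<^bsub>G\<^esub> g' \<noteq> g' \<otimes>\<^bsub>G\<^esub> g}"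

definition coding_h :: "seq \<Rightarrow> seq" where "coding_h v = v(0 := v 0 + 1)"

text \<open>
  On a line \<open>\<int>\<close> for each \<open>m = n + 1\<close> with \<open>n \<in> S\<close>, this is the transposition of \<open>0\<close> and \<open>m\<close>, and
  \<open>coding_h\<close> translates the lines. The coordinate \<open>0\<close> of a sequence is the position and
  coordinate \<open>1\<close> names the line. The translate of the transposition by \<open>k > 0\<close> exchanges \<open>k\<close> and
  \<open>m + k\<close>; it shares exactly one point with the original if \<open>k = m\<close>, and none otherwise.
\<close>

definition coding_g :: "nat set \<Rightarrow> seq \<Rightarrow> seq" where
  "coding_g S v = (if v 1 \<in> (\<lambda>n. int (Suc n)) ` S then
     v(0 := (if v 0 = 0 then v 1 else if v 0 = v 1 then 0 else v 0)) else v)"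

lemma coding_h_pow: "(coding_h ^^ n) v = v(0 := v 0 + int n)"
  by (induction n) (auto simp: coding_h_def fun_eq_iff)

lemma bij_coding_h: "bij coding_h"
  by (rule o_bij[of "\<lambda>v. v(0 := v 0 - 1)"]) (auto simp: coding_h_def fun_eq_iff)

lemma coding_g_coding_g: "coding_g S (coding_g S v) = v"
  by (auto simp: coding_g_def fun_eq_iff)

lemma bij_coding_g: "bij (coding_g S)"
  by (rule o_bij[of "coding_g S"]) (auto simp: coding_g_coding_g fun_eq_iff)

lemma coding_g_conj:
  "(coding_h ^^ m \<circ> coding_g S \<circ> finv (coding_h ^^ m)) v =
    (if v 1 \<in> (\<lambda>n. int (Suc n)) ` S then
     v(0 := (if v 0 = int m then v 1 + int m else if v 0 = v 1 + int m then int m else v 0)) else v)"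
proof -
  have "finv (coding_h ^^ m) v = v(0 := v 0 - int m)"
    using bij_fn[OF bij_coding_h, of m] bij_finv_f[of "coding_h ^^ m" "v(0 := v 0 - int m)"] by (simp add: coding_h_pow)
  then show ?thesis by (auto simp: coding_h_pow coding_g_def fun_eq_iff)
qed

lemma coding_commute: "coding_g S \<circ> (coding_h ^^ Suc n \<circ> coding_g S \<circ> finv (coding_h ^^ Suc n))
    = (coding_h ^^ Suc n \<circ> coding_g S \<circ> finv (coding_h ^^ Suc n)) \<circ> coding_g S \<longleftrightarrow> n \<notin> S"
    (is "?g \<circ> ?k = ?k \<circ> ?g \<longleftrightarrow> _")
proof
  assume e: "?g \<circ> ?k = ?k \<circ> ?g"
  show "n \<notin> S"
  proof
    assume n: "n \<in> S"
    let ?m = "int (Suc n)"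
    \<comment> \<open>On the line named by m = n + 1, the two composites send the position 0 to m and to 2 m.\<close>
    define v :: seq where "v = (\<lambda>i. if i = 0 then 0 else ?m)"
    have m: "?m \<in> (\<lambda>n. int (Suc n)) ` S" using n by blast
    have "?g (?k v) = (\<lambda>i. ?m)" unfolding coding_g_conj using m by (auto simp: v_def coding_g_def)
    moreover have "?k (?g v) = (\<lambda>i. if i = 0 then ?m + ?m else ?m)"
      unfolding coding_g_conj using m by (auto simp: v_def coding_g_def)
    ultimately have "(\<lambda>i :: nat. ?m) = (\<lambda>i. if i = 0 then ?m + ?m else ?m)"
      using fun_cong[OF e, of v] by simp
    from fun_cong[OF this, of 0] show False by simp
  qed
next
  assume n: "n \<notin> S"
  show "?g \<circ> ?k = ?k \<circ> ?g"
  proof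
    fix v
    show "(?g \<circ> ?k) v = (?k \<circ> ?g) v"
    proof (cases "v 1 \<in> (\<lambda>n. int (Suc n)) ` S")
      case True
      then have "v 1 > 0" "v 1 \<noteq> int (Suc n)" using n by auto
      then show ?thesis using True unfolding comp_apply[of ?g] comp_apply[of ?k] coding_g_conj coding_g_def
        by (auto simp: fun_eq_iff)
    next
      case False
      then show ?thesis unfolding comp_apply[of ?g] comp_apply[of ?k] coding_g_conj coding_g_def by simp
    qed
  qed
qed

lemma code_set_limgrp: "\<exists>g\<in>carrier limgrp. \<exists>h\<in>carrier limgrp. code_set limgrp g h = S"
proof -
  define e where "e f = stage 0 (map_prod f id)" for f :: "seq \<Rightarrow> seq"
  have e: "e f \<circ> e f' = e (f \<circ> f')" "e f = e f' \<longleftrightarrow> f = f'" for f f'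
  proof -
    have "map_prod f id \<circ> map_prod f' id = (map_prod (f \<circ> f') id :: seq \<times> seq \<Rightarrow> _)"
      by (simp add: fun_eq_iff)
    then show "e f \<circ> e f' = e (f \<circ> f')" by (simp only: e_def stage_comp)
    have "map_prod f id = (map_prod f' id :: seq \<times> seq \<Rightarrow> _) \<Longrightarrow> f v = f' v" for v
      by (drule fun_cong[of _ _ "(v, v)"]) simp
    then show "e f = e f' \<longleftrightarrow> f = f'" by (auto simp: e_def stage_inj)
  qed
  have eC: "e f \<in> carrier limgrp" "inv\<^bsub>limgrp\<^esub> (e f) = e (finv f)" if "bij f" for f
  proof -
    show "e f \<in> carrier limgrp" using that by (auto simp: e_def tower_def)
    then show "inv\<^bsub>limgrp\<^esub> (e f) = e (finv f)"
      using that by (simp only: limgrp_inv) (simp add: e_def stage_bij bij_map_prod_id)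
  qed
  interpret group limgrp by (rule group_limgrp)
  have pow: "e f [^]\<^bsub>limgrp\<^esub> (n :: nat) = e (f ^^ n)" for f n
  proof (induction n)
    case 0
    then show ?case by (simp add: e_def map_prod.id stage_id id_def[symmetric])
  next
    case (Suc n)
    then show ?case by (simp only: nat_pow_Suc limgrp_simps e funpow_Suc_right)
  qed
  have "code_set limgrp (e (coding_g S)) (e coding_h) = {n. coding_g S \<circ> (coding_h ^^ Suc n \<circ> coding_g S \<circ> finv (coding_h ^^ Suc n))
    \<noteq> (coding_h ^^ Suc n \<circ> coding_g S \<circ> finv (coding_h ^^ Suc n)) \<circ> coding_g S}"
    unfolding code_set_def Let_def pow eC(2)[OF bij_fn[OF bij_coding_h]] limgrp_simps e ..
  also have "\<dots> = S" unfolding coding_commute by simp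
  finally show ?thesis using eC(1) bij_coding_g bij_coding_h by blast
qed

section \<open>Countable subgroups\<close>

lemma countable_closure:
  assumes W: "\<And>x y. x \<in> C \<Longrightarrow> y \<in> C \<Longrightarrow> countable (W x y) \<and> W x y \<subseteq> C"
    and B: "B \<subseteq> C" "countable B"
  shows "\<exists>P. B \<subseteq> P \<and> P \<subseteq> C \<and> countable P \<and> (\<forall>x\<in>P. \<forall>y\<in>P. W x y \<subseteq> P)"
proof -
  define step where "step A = A \<union> (\<Union>x\<in>A. \<Union>y\<in>A. W x y)" for A
  define P where "P n = (step ^^ n) B" for n :: nat
  have Suc: "P (Suc n) = step (P n)" for n by (simp add: P_def)
  have PC: "P n \<subseteq> C \<and> countable (P n)" for n
  proof (induction n)
    case 0
    then show ?case using B by (simp add: P_def)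
  next
    case (Suc n)
    then have "countable (\<Union>x\<in>P n. \<Union>y\<in>P n. W x y)" "(\<Union>x\<in>P n. \<Union>y\<in>P n. W x y) \<subseteq> C"
      using W by (auto intro!: countable_UN)
    then show ?case using Suc.IH unfolding \<open>\<And>n. P (Suc n) = step (P n)\<close> step_def by simp
  qed
  have mono: "m \<le> n \<Longrightarrow> P m \<subseteq> P n" for m n
    by (rule lift_Suc_mono_le[of P]) (auto simp: Suc step_def)
  have "W x y \<subseteq> (\<Union>n. P n)" if "x \<in> P m" "y \<in> P k" for x y m k
  proof -
    have "x \<in> P (max m k)" "y \<in> P (max m k)"
      using that mono[of m "max m k"] mono[of k "max m k"] by auto
    then have "W x y \<subseteq> P (Suc (max m k))" by (auto simp: Suc step_def)
    then show ?thesis by blast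
  qed
  moreover have "B \<subseteq> (\<Union>n. P n)" using UN_upper[of 0 UNIV P] by (simp add: P_def)
  moreover have "(\<Union>n. P n) \<subseteq> C" "countable (\<Union>n. P n)" using PC by (blast, auto)
  ultimately show ?thesis by (intro exI[of _ "\<Union>n. P n"]) auto
qed

context group
begin

definition conjs :: "'a \<Rightarrow> 'a set \<Rightarrow> 'a set" where
  "conjs x F = (\<lambda>g. g \<otimes> x \<otimes> inv g) ` F"

lemma generate_conjs_finite:
  assumes "y \<in> generate G (conjs x C)"
  shows "\<exists>F. finite F \<and> F \<subseteq> C \<and> y \<in> generate G (conjs x F)"
  using assms
proof (induction rule: generate.induct)
  case one
  show ?case by (rule exI[of _ "{}"]) (simp add: generate.one)
next
  case (incl h)
  then obtain g where "g \<in> C" "h = g \<otimes> x \<otimes> inv g" by (auto simp: conjs_def)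
  then show ?case by (intro exI[of _ "{g}"]) (auto simp: conjs_def intro: generate.incl)
next
  case (inv h)
  then obtain g where "g \<in> C" "h = g \<otimes> x \<otimes> inv g" by (auto simp: conjs_def)
  then show ?case by (intro exI[of _ "{g}"]) (auto simp: conjs_def intro: generate.inv)
next
  case (eng h1 h2)
  then obtain F1 F2 where F: "finite F1" "F1 \<subseteq> C" "h1 \<in> generate G (conjs x F1)"
    "finite F2" "F2 \<subseteq> C" "h2 \<in> generate G (conjs x F2)" by blast
  have "h1 \<in> generate G (conjs x (F1 \<union> F2))" "h2 \<in> generate G (conjs x (F1 \<union> F2))"
    using F mono_generate[of "conjs x F1" "conjs x (F1 \<union> F2)"]
      mono_generate[of "conjs x F2" "conjs x (F1 \<union> F2)"] by (auto simp: conjs_def)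
  then show ?case using F by (intro exI[of _ "F1 \<union> F2"]) (auto intro: generate.eng)
qed

text \<open>
  Simplicity becomes a closure condition: each \<open>y\<close> is generated by conjugates of \<open>x\<close> under
  finitely many elements, and a subgroup that contains these is still able to generate \<open>y\<close> from
  \<open>x\<close>.
\<close>

lemma simple_conj_witness:
  assumes S: "is_simple_group G" and x: "x \<in> carrier G" "x \<noteq> \<one>" and y: "y \<in> carrier G"
  shows "\<exists>F. finite F \<and> F \<subseteq> carrier G \<and> y \<in> generate G (conjs x F)"
proof (rule generate_conjs_finite)
  have c: "conjs x (carrier G) \<subseteq> carrier G" using x by (auto simp: conjs_def)
  have "generate G (conjs x (carrier G)) \<lhd> G"
  proof (rule normal_generateI[OF c])
    fix h g assume "h \<in> conjs x (carrier G)" and g: "g \<in> carrier G"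
    then obtain k where k: "k \<in> carrier G" "h = k \<otimes> x \<otimes> inv k" by (auto simp: conjs_def)
    have "g \<otimes> h \<otimes> inv g = (g \<otimes> k) \<otimes> x \<otimes> inv (g \<otimes> k)"
      using k g x by (simp add: inv_mult_group m_assoc)
    then show "g \<otimes> h \<otimes> inv g \<in> conjs x (carrier G)" using k g by (auto simp: conjs_def)
  qed
  moreover have "x \<in> generate G (conjs x (carrier G))"
  proof (rule generate.incl)
    have "x = \<one> \<otimes> x \<otimes> inv \<one>" using x by simp
    then show "x \<in> conjs x (carrier G)" unfolding conjs_def by (rule image_eqI) simp
  qed
  ultimately have "generate G (conjs x (carrier G)) = carrier G"
    using S x unfolding is_simple_group_def by blast
  then show "y \<in> generate G (conjs x (carrier G))" using y by simp
qed

lemma tower_restrict: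
  assumes T: "swindle_tower G H b t" and P: "subgroup P G"
    and b: "\<And>n x. x \<in> H n \<inter> P \<Longrightarrow> b n x \<in> P" and t: "\<And>n. t n \<in> P"
  shows "swindle_tower (G\<lparr>carrier := P\<rparr>) (\<lambda>n. H n \<inter> P) b t"
proof -
  interpret P: subgroup P G by fact
  have T': "(\<Union>n. H n) = carrier G" "\<And>n. subgroup (H n) G" "\<And>n. H n \<subseteq> H (Suc n)"
    "\<And>n. b n ` H n \<subseteq> H (Suc n)" "\<And>n. t n \<in> H (Suc n)"
    using T unfolding swindle_tower_def by auto
  have "subgroup (H n \<inter> P) (G\<lparr>carrier := P\<rparr>)" for n
    by (rule subgroup_incl) (auto intro: subgroups_Inter_pair T' P)
  moreover have "(\<Union>n. H n \<inter> P) = P" using T'(1) P.subset by auto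
  moreover have "b n ` (H n \<inter> P) \<subseteq> H (Suc n) \<inter> P" for n using T'(4)[of n] b by auto
  ultimately show ?thesis
    using T T'(3,5) t unfolding swindle_tower_def by (simp add: le_infI1)
qed

lemma subgroup_is_simpleI:
  assumes P: "subgroup P G" "P \<noteq> {\<one>}"
    and w: "\<And>x y. x \<in> P \<Longrightarrow> x \<noteq> \<one> \<Longrightarrow> y \<in> P \<Longrightarrow> \<exists>F. F \<subseteq> P \<and> y \<in> generate G (conjs x F)"
  shows "is_simple_group (G\<lparr>carrier := P\<rparr>)"
  unfolding is_simple_group_def
proof (intro conjI allI impI)
  show "group (G\<lparr>carrier := P\<rparr>)" using P subgroup_imp_group by blast
  show "carrier (G\<lparr>carrier := P\<rparr>) \<noteq> {\<one>\<^bsub>G\<lparr>carrier := P\<rparr>\<^esub>}" using P by simp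
  fix N assume N: "N \<lhd> G\<lparr>carrier := P\<rparr>"
  then interpret N: normal N "G\<lparr>carrier := P\<rparr>" .
  have NP: "N \<subseteq> P" using N.subset by simp
  have NG: "subgroup N G" using incl_subgroup[OF P(1) N.subgroup_axioms] .
  show "N = carrier (G\<lparr>carrier := P\<rparr>) \<or> N = {\<one>\<^bsub>G\<lparr>carrier := P\<rparr>\<^esub>}"
  proof (cases "N \<subseteq> {\<one>}")
    case True
    then show ?thesis using subgroup.one_closed[OF NG] by auto
  next
    case False
    then obtain x where x: "x \<in> N" "x \<noteq> \<one>" by auto
    have "y \<in> N" if y: "y \<in> P" for y
    proof -
      obtain F where F: "F \<subseteq> P" "y \<in> generate G (conjs x F)" using w[of x y] x NP y by auto
      have "conjs x F \<subseteq> N"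
      proof -
        have "g \<otimes> x \<otimes> inv g \<in> N" if g: "g \<in> P" for g
          using N.inv_op_closed2[of g x] x g m_inv_consistent[OF P(1) g] by simp
        then show ?thesis using F(1) by (auto simp: conjs_def)
      qed
      then show ?thesis using generate_subgroup_incl[OF _ NG] F(2) by blast
    qed
    then show ?thesis using NP by auto
  qed
qed

text \<open>
  A Loewenheim-Skolem argument: close \<open>B\<close> under the group operations, the maps \<open>b n\<close>, the
  elements \<open>t n\<close> and the finite sets of conjugators that witness simplicity.
\<close>

theorem countable_simple_swindle_subgroup:
  assumes S: "is_simple_group G" and T: "swindle_tower G H b t"
    and B: "B \<subseteq> carrier G" "countable B" "infinite B"
  shows "\<exists>P. subgroup P G \<and> B \<subseteq> P \<and> countable P \<and> is_simple_group (G\<lparr>carrier := P\<rparr>) \<and>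
    swindle_tower (G\<lparr>carrier := P\<rparr>) (\<lambda>n. H n \<inter> P) b t"
proof -
  have T': "H n \<subseteq> carrier G" "b n ` H n \<subseteq> carrier G" "t n \<in> carrier G" for n
    using T unfolding swindle_tower_def by blast+
  define K where "K x y = (if x = \<one> then {} else SOME F. finite F \<and> F \<subseteq> carrier G \<and> y \<in> generate G (conjs x F))" for x y
  have K: "finite (K x y) \<and> K x y \<subseteq> carrier G \<and> (x \<noteq> \<one> \<longrightarrow> y \<in> generate G (conjs x (K x y)))"
    if "x \<in> carrier G" "y \<in> carrier G" for x y
    using someI_ex[OF simple_conj_witness[OF S that(1) _ that(2)]] by (auto simp: K_def)
  define W where "W x y = {x \<otimes> y, inv x} \<union> (\<Union>n. if x \<in> H n then {b n x} else {}) \<union> range t \<union> K x y" for x y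
  have "countable (W x y) \<and> W x y \<subseteq> carrier G" if "x \<in> carrier G" "y \<in> carrier G" for x y
    using K[OF that] T'(1,3) T'(2)[unfolded image_subset_iff] that
    by (auto simp: W_def countable_finite split: if_splits)
  from countable_closure[of "carrier G" W, OF this B(1,2)] obtain P where
    P: "B \<subseteq> P" "P \<subseteq> carrier G" "countable P" "\<And>x y. x \<in> P \<Longrightarrow> y \<in> P \<Longrightarrow> W x y \<subseteq> P"
    by blast
  have inf: "infinite P" using P(1) B(3) finite_subset by blast
  then obtain p where p: "p \<in> P" by (metis finite.emptyI ex_in_conv)
  have sub: "subgroup P G"
    by (rule subgroupI) (use P p in \<open>auto simp: W_def\<close>)
  have "is_simple_group (G\<lparr>carrier := P\<rparr>)"
  proof (rule subgroup_is_simpleI[OF sub])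
    show "P \<noteq> {\<one>}" using inf by auto
    fix x y assume "x \<in> P" "x \<noteq> \<one>" "y \<in> P"
    then show "\<exists>F. F \<subseteq> P \<and> y \<in> generate G (conjs x F)"
      using K[of x y] P(2) P(4)[of x y] by (auto simp: W_def)
  qed
  moreover have "swindle_tower (G\<lparr>carrier := P\<rparr>) (\<lambda>n. H n \<inter> P) b t"
  proof (rule tower_restrict[OF T sub])
    show "t n \<in> P" for n using P(4)[OF p p] by (auto simp: W_def)
    show "b n x \<in> P" if "x \<in> H n \<inter> P" for n x
      using P(4)[of x x] that by (auto simp: W_def split: if_splits)
  qed
  ultimately show ?thesis using sub P by blast
qed

end

section \<open>Copies on the real numbers\<close>

text \<open>
  Countable groups have isomorphic copies whose carrier is a set of real numbers. It is the
  tower of swindles, not its consequence in homology, that is transported to the copy.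
\<close>

lemma is_simple_group_iso:
  assumes S: "is_simple_group G" and G': "group G'" and f: "f \<in> iso G G'"
  shows "is_simple_group G'"
proof -
  have G: "group G" using S by (simp add: is_simple_group_def)
  interpret h: group_hom G G' f
    using G G' f by (simp add: group_hom_def group_hom_axioms_def iso_def)
  have bij: "bij_betw f (carrier G) (carrier G')" using f by (simp add: iso_def)
  show ?thesis
    unfolding is_simple_group_def
  proof (intro conjI allI impI G')
    show "carrier G' \<noteq> {\<one>\<^bsub>G'\<^esub>}"
    proof
      assume "carrier G' = {\<one>\<^bsub>G'\<^esub>}"
      then have "f x = f \<one>\<^bsub>G\<^esub>" if "x \<in> carrier G" for x using that h.hom_closed by auto
      then have "carrier G = {\<one>\<^bsub>G\<^esub>}" using bij by (auto simp: bij_betw_def inj_on_def)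
      then show False using S by (simp add: is_simple_group_def)
    qed
    fix N assume N: "N \<lhd> G'"
    then interpret N: normal N G' .
    let ?M = "{x \<in> carrier G. f x \<in> N}"
    have "?M \<lhd> G"
    proof (rule h.G.normal_invI)
      show "subgroup ?M G"
        by (rule h.G.subgroupI)
          (auto simp: subgroup.one_closed[OF N.subgroup_axioms] subgroup.m_closed[OF N.subgroup_axioms]
            intro: exI[of _ "\<one>\<^bsub>G\<^esub>"])
      show "g \<otimes>\<^bsub>G\<^esub> m \<otimes>\<^bsub>G\<^esub> inv\<^bsub>G\<^esub> g \<in> ?M" if "g \<in> carrier G" "m \<in> ?M" for g m
        using that N.inv_op_closed2 by auto
    qed
    then have "?M = carrier G \<or> ?M = {\<one>\<^bsub>G\<^esub>}" using S by (simp add: is_simple_group_def)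
    moreover have "N = f ` ?M" using N.subset bij by (auto simp: bij_betw_def)
    ultimately show "N = carrier G' \<or> N = {\<one>\<^bsub>G'\<^esub>}" using bij by (auto simp: bij_betw_def)
  qed
qed

lemma swindle_tower_iso:
  assumes T: "swindle_tower G H b t" and G: "group G" "group G'" and f: "f \<in> iso G G'"
  defines "g \<equiv> inv_into (carrier G) f"
  shows "swindle_tower G' (\<lambda>n. f ` H n) (\<lambda>n x. f (b n (g x))) (\<lambda>n. f (t n))"
proof -
  interpret h: group_hom G G' f
    using G f by (simp add: group_hom_def group_hom_axioms_def iso_def)
  have bij: "bij_betw f (carrier G) (carrier G')" using f by (simp add: iso_def)
  have T': "(\<Union>n. H n) = carrier G" "\<And>n. subgroup (H n) G" "\<And>n. H n \<subseteq> H (Suc n)"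
    "\<And>n x. x \<in> H n \<Longrightarrow> b n x \<in> H (Suc n)" "\<And>n. t n \<in> H (Suc n)"
    "\<And>n x y. x \<in> H n \<Longrightarrow> y \<in> H n \<Longrightarrow> b n (x \<otimes>\<^bsub>G\<^esub> y) = b n x \<otimes>\<^bsub>G\<^esub> b n y"
    "\<And>n x y. x \<in> H n \<Longrightarrow> y \<in> H n \<Longrightarrow> x \<otimes>\<^bsub>G\<^esub> b n y = b n y \<otimes>\<^bsub>G\<^esub> x"
    "\<And>n x. x \<in> H n \<Longrightarrow> t n \<otimes>\<^bsub>G\<^esub> b n x = x \<otimes>\<^bsub>G\<^esub> b n x \<otimes>\<^bsub>G\<^esub> t n"
    using T unfolding swindle_tower_def by (simp_all add: image_subset_iff)
  have C: "x \<in> carrier G" if "x \<in> H n" for x n using that T'(1) by blast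
  have bC: "b n x \<in> carrier G" if "x \<in> H n" for x n using C T'(4)[OF that] by blast
  have tC: "t n \<in> carrier G" for n using C T'(5) by blast
  have mC: "x \<otimes>\<^bsub>G\<^esub> y \<in> H n" if "x \<in> H n" "y \<in> H n" for x y n using that subgroup.m_closed T'(2) by metis
  have g: "g (f x) = x" if "x \<in> carrier G" for x
    using that bij by (simp add: g_def bij_betw_def)
  have gm: "g (f x \<otimes>\<^bsub>G'\<^esub> f y) = x \<otimes>\<^bsub>G\<^esub> y" if "x \<in> carrier G" "y \<in> carrier G" for x y
    using g[of "x \<otimes>\<^bsub>G\<^esub> y"] that by simp
  have fm: "f x \<otimes>\<^bsub>G'\<^esub> f y = f (x \<otimes>\<^bsub>G\<^esub> y)" if "x \<in> carrier G" "y \<in> carrier G" for x y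
    using that by simp
  show ?thesis
    unfolding swindle_tower_def
  proof (intro conjI allI ballI)
    show "(\<Union>n. f ` H n) = carrier G'" using T'(1) bij by (simp add: bij_betw_def flip: image_UN)
    fix n
    show "subgroup (f ` H n) G'" using h.subgroup_img_is_subgroup T'(2) by blast
    show "f ` H n \<subseteq> f ` H (Suc n)" using T'(3) by blast
    show "(\<lambda>x. f (b n (g x))) ` f ` H n \<subseteq> f ` H (Suc n)" using T'(4) C g by auto
    show "f (t n) \<in> f ` H (Suc n)" using T'(5) by blast
    fix x assume "x \<in> f ` H n"
    then obtain u where u: "x = f u" "u \<in> H n" by blast
    show "f (t n) \<otimes>\<^bsub>G'\<^esub> f (b n (g x)) = x \<otimes>\<^bsub>G'\<^esub> f (b n (g x)) \<otimes>\<^bsub>G'\<^esub> f (t n)"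
      using u C[OF u(2)] bC[OF u(2)] tC T'(8)[OF u(2)] by (simp add: g fm del: h.hom_mult)
    fix y assume "y \<in> f ` H n"
    then obtain v where v: "y = f v" "v \<in> H n" by blast
    show "f (b n (g (x \<otimes>\<^bsub>G'\<^esub> y))) = f (b n (g x)) \<otimes>\<^bsub>G'\<^esub> f (b n (g y))"
      using u v C bC T'(6)[OF u(2) v(2)] by (simp add: g gm)
    show "x \<otimes>\<^bsub>G'\<^esub> f (b n (g y)) = f (b n (g y)) \<otimes>\<^bsub>G'\<^esub> x"
      using u v C bC T'(7)[OF u(2) v(2)] by (simp add: g fm del: h.hom_mult)
  qed
qed

definition codes :: "('a, 'b) monoid_scheme \<Rightarrow> nat set set" where
  "codes G = {code_set G g h | g h. g \<in> carrier G \<and> h \<in> carrier G}"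

lemma code_set_iso:
  assumes G: "group G" "group G'" and f: "f \<in> iso G G'" and x: "x \<in> carrier G" "y \<in> carrier G"
  shows "code_set G' (f x) (f y) = code_set G x y"
proof -
  interpret h: group_hom G G' f
    using G f by (simp add: group_hom_def group_hom_axioms_def iso_def)
  have inj: "inj_on f (carrier G)" using f by (simp add: iso_def bij_betw_def)
  have "(let k = f y [^]\<^bsub>G'\<^esub> Suc n; g' = k \<otimes>\<^bsub>G'\<^esub> f x \<otimes>\<^bsub>G'\<^esub> inv\<^bsub>G'\<^esub> k in f x \<otimes>\<^bsub>G'\<^esub> g' \<noteq> g' \<otimes>\<^bsub>G'\<^esub> f x)
    \<longleftrightarrow> (let k = y [^]\<^bsub>G\<^esub> Suc n; g' = k \<otimes>\<^bsub>G\<^esub> x \<otimes>\<^bsub>G\<^esub> inv\<^bsub>G\<^esub> k in x \<otimes>\<^bsub>G\<^esub> g' \<noteq> g' \<otimes>\<^bsub>G\<^esub> x)" for n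
  proof -
    define k where "k = y [^]\<^bsub>G\<^esub> Suc n"
    have kC: "k \<in> carrier G" using x by (simp add: k_def del: nat_pow_Suc)
    have fk: "f y [^]\<^bsub>G'\<^esub> Suc n = f k" unfolding k_def using h.hom_nat_pow[OF x(2)] by metis
    define g' where "g' = k \<otimes>\<^bsub>G\<^esub> x \<otimes>\<^bsub>G\<^esub> inv\<^bsub>G\<^esub> k"
    have gC: "g' \<in> carrier G" using kC x by (simp add: g'_def)
    have fg: "f k \<otimes>\<^bsub>G'\<^esub> f x \<otimes>\<^bsub>G'\<^esub> inv\<^bsub>G'\<^esub> (f k) = f g'" using kC x by (simp add: g'_def)
    have "f x \<otimes>\<^bsub>G'\<^esub> f g' = f g' \<otimes>\<^bsub>G'\<^esub> f x \<longleftrightarrow> f (x \<otimes>\<^bsub>G\<^esub> g') = f (g' \<otimes>\<^bsub>G\<^esub> x)" using gC x by simp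
    also have "\<dots> \<longleftrightarrow> x \<otimes>\<^bsub>G\<^esub> g' = g' \<otimes>\<^bsub>G\<^esub> x" using inj gC x by (simp add: inj_on_eq_iff del: h.hom_mult)
    finally show ?thesis unfolding Let_def fk fg k_def[symmetric] g'_def[symmetric] by simp
  qed
  then show ?thesis unfolding code_set_def by simp
qed

lemma codes_iso:
  assumes G: "group G" "group G'" and i: "G \<cong> G'"
  shows "codes G' = codes G"
proof -
  obtain f where f: "f \<in> iso G G'" using i by (auto simp: is_iso_def)
  then have "carrier G' = f ` carrier G" by (simp add: iso_def bij_betw_def)
  then have "codes G' = {code_set G' (f g) (f h) | g h. g \<in> carrier G \<and> h \<in> carrier G}"
    unfolding codes_def \<open>carrier G' = f ` carrier G\<close> by auto
  also have "\<dots> = codes G"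
    unfolding codes_def using code_set_iso[OF G f] by (intro Collect_cong ex_cong1) auto
  finally show ?thesis .
qed

lemma code_set_subgroup:
  assumes G: "group G" and P: "subgroup P G" and x: "x \<in> P" "y \<in> P"
  shows "code_set (G\<lparr>carrier := P\<rparr>) x y = code_set G x y"
proof -
  interpret group G by fact
  interpret P: group "G\<lparr>carrier := P\<rparr>" using subgroup_imp_group[OF P] .
  have k: "y [^]\<^bsub>G\<^esub> Suc n \<in> P" for n
    using P.nat_pow_closed[of y "Suc n"] x by (simp add: nat_pow_consistent[symmetric] del: nat_pow_Suc)
  show ?thesis
    unfolding code_set_def nat_pow_consistent[of y, symmetric] using m_inv_consistent[OF P k] by (simp add: Let_def)
qed

lemma countable_codes: "countable (carrier G) \<Longrightarrow> countable (codes G)"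
proof -
  assume "countable (carrier G)"
  then have "countable ((\<lambda>(g, h). code_set G g h) ` (carrier G \<times> carrier G))" by simp
  moreover have "codes G = (\<lambda>(g, h). code_set G g h) ` (carrier G \<times> carrier G)" by (auto simp: codes_def)
  ultimately show ?thesis by simp
qed

lemma ex_real_copy:
  fixes G :: "('a, 'b) monoid_scheme"
  assumes G: "group G" and c: "countable (carrier G)"
  shows "\<exists>R :: real monoid. group R \<and> G \<cong> R"
proof -
  interpret group G by fact
  obtain n :: "'a \<Rightarrow> nat" where n: "inj_on n (carrier G)" using c by (auto simp: countable_def)
  define f where "f x = real (n x)" for x
  have f: "inj_on f (carrier G)" using n by (auto simp: f_def inj_on_def)
  let ?g = "inv_into (carrier G) f"
  define R where "R = \<lparr>carrier = f ` carrier G, monoid.mult = (\<lambda>x y. f (?g x \<otimes>\<^bsub>G\<^esub> ?g y)), one = f \<one>\<^bsub>G\<^esub>\<rparr>"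
  have "f \<in> iso G R"
    using f by (auto simp: iso_def hom_def R_def bij_betw_def)
  moreover from this have "group R" using iso_imp_img_group[of f R] f by (simp add: R_def)
  ultimately show ?thesis by (auto simp: is_iso_def)
qed

section \<open>Continuum many groups\<close>

lemma ex_group_with_code:
  "\<exists>R :: real monoid. is_simple_group R \<and> infinite (carrier R) \<and> integrally_acyclic R \<and>
     countable (carrier R) \<and> S \<in> codes R"
proof -
  interpret limgrp: group limgrp by (rule group_limgrp)
  obtain g h where gh: "g \<in> carrier limgrp" "h \<in> carrier limgrp" "code_set limgrp g h = S"
    using code_set_limgrp by blast
  have "infinite (carrier limgrp)"
  proof
    assume "finite (carrier limgrp)"
    then have "finite ((\<lambda>(g, h). code_set limgrp g h) ` (carrier limgrp \<times> carrier limgrp))" by simp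
    moreover have "UNIV \<subseteq> (\<lambda>(g, h). code_set limgrp g h) ` (carrier limgrp \<times> carrier limgrp)"
    proof
      fix T :: "nat set"
      obtain g h where "g \<in> carrier limgrp" "h \<in> carrier limgrp" "code_set limgrp g h = T"
        using code_set_limgrp by blast
      then show "T \<in> (\<lambda>(g, h). code_set limgrp g h) ` (carrier limgrp \<times> carrier limgrp)"
        by (intro rev_image_eqI[of "(g, h)"]) (simp_all del: limgrp_simps)
    qed
    ultimately have "finite (UNIV :: nat set set)" by (metis finite_subset)
    then show False by (simp add: Finite_Set.finite_set)
  qed
  then obtain C where C: "C \<subseteq> carrier limgrp" "countable C" "infinite C"
    using infinite_countable_subset' by blast
  let ?B = "insert g (insert h C)"
  obtain P where P: "subgroup P limgrp" "?B \<subseteq> P" "countable P" "is_simple_group (limgrp\<lparr>carrier := P\<rparr>)"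
    "swindle_tower (limgrp\<lparr>carrier := P\<rparr>) (\<lambda>n. tower n \<inter> P) swindle_b swindle_t"
  proof -
    have "?B \<subseteq> carrier limgrp" "countable ?B" "infinite ?B" using C gh(1,2) by (simp_all del: limgrp_simps)
    from limgrp.countable_simple_swindle_subgroup[OF simple_limgrp swindle_tower_limgrp this] that
    show thesis by blast
  qed
  let ?P = "limgrp\<lparr>carrier := P\<rparr>"
  have gP: "group ?P" using P(4) by (simp add: is_simple_group_def)
  obtain R :: "real monoid" where R: "group R" "?P \<cong> R"
    using ex_real_copy[OF gP] P(3) by auto
  then obtain f where f: "f \<in> iso ?P R" by (auto simp: is_iso_def)
  have bij: "bij_betw f P (carrier R)" using f by (simp add: iso_def)
  have "integrally_acyclic R"
    by (rule group.swindle_tower_acyclic[OF R(1) swindle_tower_iso[OF P(5) gP R(1) f]])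
  moreover have "infinite P" using infinite_super[of C P] C(3) P(2) by simp
  then have "infinite (carrier R)" using bij_betw_finite[OF bij] by simp
  moreover have "countable (carrier R)"
    using countable_image[OF P(3), of f] bij_betw_imp_surj_on[OF bij] by simp
  moreover have "S \<in> codes ?P"
  proof -
    have "g \<in> P" "h \<in> P" using P(2) by simp_all
    moreover from this have "code_set ?P g h = S"
      using code_set_subgroup[OF group_limgrp P(1)] gh(3) by simp
    ultimately show ?thesis unfolding codes_def by (intro CollectI exI[of _ g] exI[of _ h]) simp
  qed
  then have "S \<in> codes R" using codes_iso[OF gP R] by simp
  moreover have "is_simple_group R" by (rule is_simple_group_iso[OF P(4) R(1) f])
  ultimately show ?thesis by (intro exI[of _ R] conjI)
qed

text \<open>
  One representative is chosen from each isomorphism class of the groups \<open>R S\<close>. The sets coded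
  by the representatives exhaust the power set of \<open>\<nat>\<close>, each of them codes countably many, so
  there are continuum many of them.
\<close>

theorem mainTheorem14:
  shows "\<exists>\<S> :: real monoid set.
    \<S> \<approx> (UNIV :: real set) \<and>
    (\<forall>G\<in>\<S>. is_simple_group G \<and> infinite (carrier G) \<and> integrally_acyclic G) \<and>
    pairwise (\<lambda>G H. \<not> G \<cong> H) \<S>"
proof -
  obtain R :: "nat set \<Rightarrow> real monoid" where
    R: "\<And>S. is_simple_group (R S) \<and> infinite (carrier (R S)) \<and> integrally_acyclic (R S) \<and>
      countable (carrier (R S)) \<and> S \<in> codes (R S)"
    using ex_group_with_code by metis
  have grp: "group (R S)" for S using R[of S] by (simp add: is_simple_group_def)
  define c where "c S = (SOME T. R T \<cong> R S)" for S
  have c: "R (c S) \<cong> R S" for S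
    unfolding c_def by (rule someI[of _ S]) (rule iso_refl)
  have c_eq: "c S = c T" if "R S \<cong> R T" for S T
  proof -
    have "R U \<cong> R S \<longleftrightarrow> R U \<cong> R T" for U
      using that group.iso_sym[OF grp] iso_trans by metis
    then show ?thesis by (simp add: c_def)
  qed
  define \<S> where "\<S> = range (\<lambda>S. R (c S))"
  have "pairwise (\<lambda>G H. \<not> G \<cong> H) \<S>"
  proof (rule pairwiseI)
    fix G H assume "G \<in> \<S>" "H \<in> \<S>" and ne: "G \<noteq> H"
    then obtain S T where ST: "G = R (c S)" "H = R (c T)" by (auto simp: \<S>_def)
    show "\<not> G \<cong> H"
    proof
      assume "G \<cong> H"
      then have "R S \<cong> R T" using c ST group.iso_sym[OF grp] iso_trans by metis
      then show False using c_eq ST ne by simp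
    qed
  qed
  moreover have "\<S> \<approx> (UNIV :: real set)"
  proof -
    have cover: "(UNIV :: nat set set) = (\<Union>G\<in>\<S>. codes G)"
    proof -
      have "S \<in> codes (R (c S))" for S using R[of S] codes_iso[OF grp grp c] by blast
      then show ?thesis by (auto simp: \<S>_def)
    qed
    have cnt: "countable (codes G)" if "G \<in> \<S>" for G
      using that R countable_codes by (auto simp: \<S>_def)
    have inf: "infinite \<S>"
    proof
      assume "finite \<S>"
      then have "countable (UNIV :: nat set set)"
        unfolding cover using cnt by (intro countable_UN) (auto simp: countable_finite)
      then obtain f :: "nat set \<Rightarrow> nat" where f: "inj f" by (auto simp: countable_def)
      define D where "D = f ` {A. f A \<notin> A}"
      have "f A \<in> D \<longleftrightarrow> f A \<notin> A" for A using inj_eq[OF f] by (auto simp: D_def image_iff)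
      from this[of D] show False by blast
    qed
    have "|\<Union>G\<in>\<S>. codes G| \<le>o |\<S>|"
    proof (rule card_of_UNION_ordLeq_infinite[OF inf card_of_mono1[OF order_refl]], rule ballI)
      fix G assume "G \<in> \<S>"
      have "|codes G| \<le>o |UNIV :: nat set|"
        using cnt[OF \<open>G \<in> \<S>\<close>] unfolding countable_def card_of_ordLeq[symmetric] by auto
      moreover have "|UNIV :: nat set| \<le>o |\<S>|" using inf infinite_iff_card_of_nat by blast
      ultimately show "|codes G| \<le>o |\<S>|" by (rule ordLeq_transitive)
    qed
    then have "(UNIV :: nat set set) \<lesssim> \<S>"
      unfolding cover[symmetric] lepoll_def card_of_ordLeq .
    moreover have "\<S> \<lesssim> (UNIV :: nat set set)" unfolding \<S>_def by (rule image_lepoll)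
    ultimately have "\<S> \<approx> (UNIV :: nat set set)" by (simp add: lepoll_antisym)
    then show ?thesis using nat_sets_eqpoll_reals by (rule eqpoll_trans)
  qed
  moreover have "\<forall>G\<in>\<S>. is_simple_group G \<and> infinite (carrier G) \<and> integrally_acyclic G"
    using R by (auto simp: \<S>_def)
  ultimately show ?thesis by blast
qed

end
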